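(* Let $\mu$ be a finite positive Borel measure on $\mathbb{D}$, let $\Psi_1,\Psi_2$ be Orlicz functions, and let $I_\mu\colon\mathfrak{B}^{\Psi_1}\to L^{\Psi_2}(\mu)$ be the canonical map $I_\mu(f)=f$. (1) If $I_\mu$ is compact, then $$\lim_{h\to0}\frac{\Psi_1^{-1}(1/h^2)}{\Psi_2^{-1}\big(1/\rho_\mu(h)\big)}=0.$$ (2) For $I_\mu$ to be compact, it suffices that $$\lim_{h\to0}\frac{\Psi_1^{-1}(1/h^2)}{\Psi_2^{-1}\big(1/(h^2K_{\mu,2}(h))\big)}=0.$$
   Context: $\mathbb{D}$ is the open unit disk, $\mathbb{T}$ the unit circle, $\mathcal{A}$ the normalized area measure $dx\,dy/\pi$. An Orlicz function is a nonnegative increasing convex $\Psi\colon[0,\infty)\to[0,\infty)$ with $\Psi(0)=0$, $\Psi(x)>0$ for $x>0$, $\Psi(\infty)=\infty$; $\Psi^{-1}$ is its inverse, with $\Psi^{-1}(\infty)=\infty$. $L^{\Psi}(\mu)$ is the Orlicz space with Luxemburg norm $\|f\|=\inf\{C>0:\int\Psi(|f|/C)\,d\mu\le1\}$; $\mathfrak{B}^{\Psi}$ is the subspace of $L^{\Psi}(\mathbb{D},\mathcal{A})$ of analytic functions. For $\xi\in\mathbb{T}$, $0<h\le1$: $W(\xi,h)=\{z\in\mathbb{D}:|z|\ge1-h,\ |\arg(z\bar\xi)|\le\pi h\}$; $\rho_\mu(h)=\sup_{\xi\in\mathbb{T}}\mu(W(\xi,h))$; $K_{\mu,2}(h)=\sup_{0<t<h}\rho_\mu(t)/t^2$.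 Compact means mapping bounded sets to relatively compact sets (in (2) this includes that every $f\in\mathfrak{B}^{\Psi_1}$ lies in $L^{\Psi_2}(\mu)$). *)

theory Defs
  imports "HOL-Analysis.Analysis"
begin

definition orlicz_fun :: "(real \<Rightarrow> real) \<Rightarrow> bool" where
  "orlicz_fun Psi \<longleftrightarrow>
     (\<forall>x\<ge>0. Psi x \<ge> 0) \<and> mono_on {0..} Psi \<and> convex_on {0..} Psi \<and>
     Psi 0 = 0 \<and> (\<forall>x>0. Psi x > 0) \<and> filterlim Psi at_top at_top"

definition orlicz_inv :: "(real \<Rightarrow> real) \<Rightarrow> real \<Rightarrow> real" where
  "orlicz_inv Psi y = (THE x. x \<ge> 0 \<and> Psi x = y)"

definition orlicz_inv_e :: "(real \<Rightarrow> real) \<Rightarrow> ereal \<Rightarrow> ereal" where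
  "orlicz_inv_e Psi y = (if y = \<infinity> then \<infinity> else ereal (orlicz_inv Psi (real_of_ereal y)))"

definition in_orlicz :: "complex measure \<Rightarrow> (real \<Rightarrow> real) \<Rightarrow> (complex \<Rightarrow> complex) \<Rightarrow> bool" where
  "in_orlicz M Psi f \<longleftrightarrow> f \<in> borel_measurable M \<and>
     (\<exists>C>0. (\<integral>\<^sup>+ z. ennreal (Psi (norm (f z) / C)) \<partial>M) \<le> 1)"

definition lux_norm :: "complex measure \<Rightarrow> (real \<Rightarrow> real) \<Rightarrow> (complex \<Rightarrow> complex) \<Rightarrow> real" where
  "lux_norm M Psi f = Inf {C. C > 0 \<and> (\<integral>\<^sup>+ z. ennreal (Psi (norm (f z) / C)) \<partial>M) \<le> 1}"

definition areaD :: "complex measure" where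
  "areaD = density lborel (\<lambda>z. ennreal (indicator (ball 0 1) z / pi))"

text \<open>Bergman-Orlicz space: analytic functions on the disc lying in L^Psi(areaD)
  (represented as functions vanishing off the disc).\<close>
definition bergman_orlicz :: "(real \<Rightarrow> real) \<Rightarrow> (complex \<Rightarrow> complex) set" where
  "bergman_orlicz Psi = {f. f holomorphic_on ball 0 1 \<and> (\<forall>z. z \<notin> ball 0 1 \<longrightarrow> f z = 0)
      \<and> in_orlicz areaD Psi f}"

text \<open>Compactness of the canonical map B^Psi1 -> L^Psi2(mu): it is well defined and maps
  bounded sets to relatively compact sets (sequential characterization in the metric space
  L^Psi2(mu)).\<close>
definition compact_embedding :: "complex measure \<Rightarrow> (real \<Rightarrow> real) \<Rightarrow> (real \<Rightarrow> real) \<Rightarrow> bool" where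
  "compact_embedding mu Psi1 Psi2 \<longleftrightarrow>
     (\<forall>f\<in>bergman_orlicz Psi1. in_orlicz mu Psi2 f) \<and>
     (\<forall>(F :: nat \<Rightarrow> complex \<Rightarrow> complex) (C::real). (\<forall>n. F n \<in> bergman_orlicz Psi1 \<and> lux_norm areaD Psi1 (F n) \<le> C) \<longrightarrow>
        (\<exists>r g. strict_mono r \<and> in_orlicz mu Psi2 g \<and>
           ((\<lambda>n. lux_norm mu Psi2 (\<lambda>z. F (r n) z - g z)) \<longlongrightarrow> 0) sequentially))"

definition window :: "complex \<Rightarrow> real \<Rightarrow> complex set" where
  "window xi h = {z \<in> ball 0 1. norm z \<ge> 1 - h \<and> \<bar>Arg (z * cnj xi)\<bar> \<le> pi * h}"

definition rho :: "complex measure \<Rightarrow> real \<Rightarrow> real" where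
  "rho mu h = (SUP xi \<in> sphere 0 1. measure mu (window xi h))"

definition K2 :: "complex measure \<Rightarrow> real \<Rightarrow> ereal" where
  "K2 mu h = (SUP t \<in> {0<..<h}. ereal (rho mu t / t ^ 2))"


end

theory Submission
  imports Defs "HOL-Complex_Analysis.Complex_Analysis"
begin

text \<open>
  Sufficiency. For \<open>g\<close> analytic, the sub-mean value property and Jensen's inequality bound \<open>\<Psi>\<^sub>1(|g(z)|)\<close>
  by \<open>4/t\<^sup>2\<close> times the integral of \<open>\<Psi>\<^sub>1(|g|)\<close> over the disc of radius \<open>t/2\<close> about \<open>z\<close>, where \<open>t = 1 - |z|\<close>.
  If that integral is at most 1, then \<open>4t\<close> is at most \<open>h = 8/\<Psi>\<^sub>1(|g(z)|)\<^sup>1\<^sup>/\<^sup>2\<close>, and the hypothesis at this scale \<open>h\<close> turns into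
  the pointwise inequality \<open>\<Psi>\<^sub>2(a|g(z)|) K(4t) \<le> \<epsilon> \<Psi>\<^sub>1(|g(z)|)\<close> wherever \<open>|g(z)|\<close> is large. Since
  the points \<open>z\<close> whose disc contains a given \<open>w\<close> lie in a window of size \<open>2(1 - |w|) \<le> 4t\<close>, Fubini gives
  that the integral of \<open>\<Psi>\<^sub>2(a|g|)\<close> over a thin annulus is small uniformly in the unit ball, and Montel's theorem
  concludes.

  Necessity. The normalised fourth powers \<open>c \<Psi>\<^sub>1\<^sup>-\<^sup>1(1/h\<^sup>2) (h/(1 - (1-h) cnj \<xi> z))\<^sup>4\<close> lie in the unit ball, are of size
  \<open>\<Psi>\<^sub>1\<^sup>-\<^sup>1(1/h\<^sup>2)\<close> on the window at \<open>\<xi>\<close>, and tend to 0 pointwise. By compactness a subsequence of their images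
  tends to 0 in norm, which bounds the measure of the windows.
\<close>

section \<open>Orlicz functions\<close>

lemma orlicz_nonneg: "orlicz_fun P \<Longrightarrow> 0 \<le> x \<Longrightarrow> 0 \<le> P x"
  by (simp add: orlicz_fun_def)

lemma orlicz_zero: "orlicz_fun P \<Longrightarrow> P 0 = 0"
  by (simp add: orlicz_fun_def)

lemma orlicz_pos: "orlicz_fun P \<Longrightarrow> 0 < x \<Longrightarrow> 0 < P x"
  by (simp add: orlicz_fun_def)

lemma orlicz_mono: "orlicz_fun P \<Longrightarrow> 0 \<le> x \<Longrightarrow> x \<le> y \<Longrightarrow> P x \<le> P y"
  unfolding orlicz_fun_def mono_on_def by auto

lemma orlicz_convexD:
  assumes "orlicz_fun P" "0 \<le> t" "t \<le> 1" "0 \<le> x" "0 \<le> y"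
  shows "P ((1 - t) * x + t * y) \<le> (1 - t) * P x + t * P y"
  using convex_onD[of "{0..}" P t x y] assms by (auto simp: orlicz_fun_def)

text \<open>Convexity on the segment from 0 to \<open>x\<close>, together with
  \<open>P 0 = 0\<close>. This is how constants inside \<open>P\<close> are later traded for factors
  in front of it.\<close>

lemma orlicz_scale:
  assumes "orlicz_fun P" "0 \<le> l" "l \<le> 1" "0 \<le> x"
  shows "P (l * x) \<le> l * P x"
  using orlicz_convexD[of P l 0 x] orlicz_zero[of P] assms by simp

text \<open>Monotonicity is assumed only weakly. Strictness comes from writing
  \<open>x = (x/y) * y\<close>, scaling, and using \<open>P y > 0\<close>.\<close>

lemma orlicz_strict_mono:
  assumes "orlicz_fun P" "0 \<le> x" "x < y"
  shows "P x < P y"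
proof -
  have "P (x / y * y) \<le> x / y * P y"
    using assms by (intro orlicz_scale) auto
  also have "\<dots> < 1 * P y"
    using assms orlicz_pos[of P y] by (intro mult_strict_right_mono) auto
  finally show ?thesis using assms by simp
qed

lemma orlicz_le_iff:
  assumes "orlicz_fun P" "0 \<le> x" "0 \<le> y"
  shows "P x \<le> P y \<longleftrightarrow> x \<le> y"
  using assms orlicz_mono[of P x y] orlicz_strict_mono[of P y x] by (meson not_le)

text \<open>Convexity gives continuity on the open half-line; at the endpoint 0 the function is
  squeezed between 0 and \<open>t * P 1\<close>.\<close>

lemma orlicz_continuous_on:
  assumes P: "orlicz_fun P"
  shows "continuous_on {0..} P"
proof -
  have "continuous (at x within {0..}) P" if x: "0 \<le> x" for x
  proof (cases "x = 0")
    case True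
    have "((\<lambda>t. t * P 1) \<longlongrightarrow> 0 * P 1) (at 0 within {0..})"
      by (intro tendsto_intros)
    then have lim: "((\<lambda>t. t * P 1) \<longlongrightarrow> 0) (at 0 within {0..})" by simp
    have "(P \<longlongrightarrow> 0) (at 0 within {0..})"
    proof (rule tendsto_sandwich[OF _ _ tendsto_const lim])
      show "\<forall>\<^sub>F t in at 0 within {0..}. 0 \<le> P t"
        by (auto simp: eventually_at_filter P orlicz_nonneg)
      have "\<forall>\<^sub>F t in at (0::real) within {0..}. dist t 0 < 1"
        unfolding eventually_at by (rule exI[of _ 1]) auto
      moreover have "\<forall>\<^sub>F t in at (0::real) within {0..}. t \<in> {0..}"
        by (auto simp: eventually_at_filter)
      ultimately show "\<forall>\<^sub>F t in at 0 within {0..}. P t \<le> t * P 1"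
      proof eventually_elim
        case (elim t)
        then show ?case using orlicz_scale[OF P, of t 1] by (simp add: dist_real_def)
      qed
    qed
    then show ?thesis using True orlicz_zero[OF P] by (simp add: continuous_within)
  next
    case False
    have "convex_on {0<..} P"
      using P unfolding orlicz_fun_def by (auto intro: convex_on_subset)
    then have "continuous_on {0<..} P"
      by (intro convex_on_continuous) auto
    then have "isCont P x"
      using x False by (simp add: continuous_on_eq_continuous_at)
    then show ?thesis by (rule continuous_at_imp_continuous_at_within)
  qed
  then show ?thesis by (simp add: continuous_on_eq_continuous_within)
qed

lemma orlicz_surj:
  assumes P: "orlicz_fun P" and y: "0 \<le> y"
  obtains x where "0 \<le> x" "P x = y"
proof -
  have "\<forall>\<^sub>F x in at_top. y \<le> P x"
    using P by (auto simp: orlicz_fun_def filterlim_at_top)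
  then obtain b where b: "\<And>x. b \<le> x \<Longrightarrow> y \<le> P x"
    by (auto simp: eventually_at_top_linorder)
  have "continuous_on {0..max b 0} P"
    by (rule continuous_on_subset[OF orlicz_continuous_on[OF P]]) auto
  then have "\<exists>x. 0 \<le> x \<and> x \<le> max b 0 \<and> P x = y"
    using y orlicz_zero[OF P] b by (intro IVT') auto
  then show ?thesis using that by blast
qed

lemma orlicz_inv_eq:
  assumes "orlicz_fun P" "0 \<le> x"
  shows "orlicz_inv P (P x) = x"
  unfolding orlicz_inv_def
proof (rule the_equality)
  fix z assume "0 \<le> z \<and> P z = P x"
  then show "z = x"
    using assms orlicz_le_iff[of P x z] orlicz_le_iff[of P z x] by auto
qed (use assms in auto)

text \<open>The definite description in \<open>orlicz_inv\<close> denotes: a preimage exists by the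
  intermediate value theorem and is unique by strict monotonicity.\<close>

lemma orlicz_inv:
  assumes "orlicz_fun P" "0 \<le> y"
  shows orlicz_inv_nonneg: "0 \<le> orlicz_inv P y"
    and orlicz_orlicz_inv: "P (orlicz_inv P y) = y"
  using orlicz_surj[OF assms] orlicz_inv_eq[OF assms(1)] by metis+

lemma le_orlicz_inv_iff:
  assumes "orlicz_fun P" "0 \<le> x" "0 \<le> y"
  shows "x \<le> orlicz_inv P y \<longleftrightarrow> P x \<le> y"
  using orlicz_le_iff[of P x "orlicz_inv P y"] orlicz_inv[of P y] assms by simp

text \<open>Supplies the affine minorant for Jensen's inequality. The slope is the infimum of the
  chord slopes to the right of \<open>a\<close>, which is nonnegative because \<open>P\<close>
  increases; at \<open>a = 0\<close> the zero slope serves.\<close>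

lemma orlicz_supporting_line:
  assumes P: "orlicz_fun P" and a: "0 \<le> a"
  obtains c where "0 \<le> c" "\<And>x. 0 \<le> x \<Longrightarrow> P a + c * (x - a) \<le> P x"
proof (cases "a = 0")
  case True
  then show ?thesis using that[of 0] P by (simp add: orlicz_zero orlicz_nonneg)
next
  case False
  define c where "c = Inf ((\<lambda>t. (P a - P t) / (a - t)) ` ({a<..} \<inter> {0..}))"
  have "P a + c * (x - a) \<le> P x" if "0 \<le> x" for x
    using convex_le_Inf_differential[of "{0..}" P a x] P a False that
    by (simp add: orlicz_fun_def c_def interior_real_atLeast)
  moreover have "0 \<le> c"
    unfolding c_def
  proof (rule cInf_greatest)
    show "(\<lambda>t. (P a - P t) / (a - t)) ` ({a<..} \<inter> {0..}) \<noteq> {}"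
    proof -
      have "a + 1 \<in> {a<..} \<inter> {0..}" using a by simp
      then show ?thesis by blast
    qed
    fix s assume "s \<in> (\<lambda>t. (P a - P t) / (a - t)) ` ({a<..} \<inter> {0..})"
    then obtain t where "a < t" "s = (P a - P t) / (a - t)" by auto
    then show "0 \<le> s"
      using orlicz_mono[OF P a, of t] by (auto intro: divide_nonpos_neg)
  qed
  ultimately show ?thesis using that by blast
qed

lemma orlicz_measurable:
  assumes P: "orlicz_fun P" and f: "f \<in> borel_measurable M" and nn: "\<And>z. z \<in> space M \<Longrightarrow> 0 \<le> f z"
  shows "(\<lambda>z. P (f z)) \<in> borel_measurable M"
proof -
  \<comment> \<open>\<open>P\<close> is unconstrained on the negative axis, so it is replaced by a
    function that is monotone on the whole line and agrees with it on the values of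
    \<open>f\<close>.\<close>
  have "mono (\<lambda>x. P (max 0 x))"
    by (auto simp: mono_def intro!: orlicz_mono[OF P])
  then have "(\<lambda>x. P (max 0 x)) \<in> borel_measurable borel"
    by (rule borel_measurable_mono)
  then have "(\<lambda>z. P (max 0 (f z))) \<in> borel_measurable M"
    using f by measurable
  then show ?thesis
    by (rule measurable_cong[THEN iffD1, rotated]) (use nn in auto)
qed

section \<open>Area mean value property\<close>

lemma prod_Basis_complex: "(\<Prod>b\<in>Basis. f b) = f 1 * f \<i>" for f :: "complex \<Rightarrow> real"
  by (simp add: Basis_complex_def)

lemma prod_Basis_vec2: "(\<Prod>b\<in>Basis. f b) = f (axis 1 1) * f (axis 2 1)" for f :: "real^2 \<Rightarrow> real"
proof -
  have B: "(Basis :: (real^2) set) = {axis 1 1, axis 2 1}"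
    by (auto simp: Basis_vec_def UNIV_2)
  have "axis 1 1 \<noteq> (axis 2 1 :: real^2)"
    by (simp add: axis_eq_axis)
  then show ?thesis unfolding B by (subst prod.insert) auto
qed

text \<open>The identification through which invariance of Lebesgue measure under orthogonal maps of
  \<open>real^2\<close> is carried over to rotations of the complex plane.\<close>

definition vec_complex :: "real^2 \<Rightarrow> complex" where
  "vec_complex x = Complex (x $ 1) (x $ 2)"

definition complex_vec :: "complex \<Rightarrow> real^2" where
  "complex_vec z = vector [Re z, Im z]"

lemma vec_complex_inverse [simp]:
  "vec_complex (complex_vec z) = z" "complex_vec (vec_complex x) = x"
  by (simp_all add: vec_complex_def complex_vec_def vec_eq_iff forall_2)

lemma continuous_on_vec_complex: "continuous_on A vec_complex"
  unfolding vec_complex_def Complex_eq by (intro continuous_intros)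

lemma bounded_linear_vec_complex: "bounded_linear vec_complex"
  unfolding linear_conv_bounded_linear[symmetric]
  by (rule linearI) (auto simp: vec_complex_def complex_eq_iff)

lemma bounded_linear_complex_vec: "bounded_linear complex_vec"
  unfolding linear_conv_bounded_linear[symmetric]
  by (rule linearI) (auto simp: complex_vec_def vec_eq_iff forall_2)

lemma norm_complex_vec: "norm (complex_vec z) = norm z"
  by (simp add: norm_vec_def L2_set_def sum_2 complex_vec_def cmod_def)

text \<open>Lebesgue measure is determined by its values on boxes, and the preimage of a box is a
  box with the same side lengths.\<close>

lemma lborel_vec_complex: "distr lborel borel vec_complex = lborel"
proof (rule lborel_eqI[symmetric])
  have [measurable]: "vec_complex \<in> borel_measurable borel"
    by (rule borel_measurable_continuous_onI[OF continuous_on_vec_complex])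
  fix l u :: complex
  assume lu: "\<And>b. b \<in> Basis \<Longrightarrow> l \<bullet> b \<le> u \<bullet> b"
  have "vec_complex -` box l u = box (complex_vec l) (complex_vec u)"
    by (auto simp: mem_box_cart forall_2 in_box_complex_iff vec_complex_def complex_vec_def)
  moreover have "complex_vec l \<bullet> b \<le> complex_vec u \<bullet> b" if "b \<in> Basis" for b
    using lu[of 1] lu[of \<i>] that
    by (auto simp: Basis_vec_def complex_vec_def inner_axis Basis_complex_def)
       (metis (full_types) exhaust_2 vector_2)
  ultimately show "emeasure (distr lborel borel vec_complex) (box l u) = (\<Prod>b\<in>Basis. (u - l) \<bullet> b)"
    by (simp add: emeasure_distr emeasure_lborel_box prod_Basis_complex prod_Basis_vec2
        inner_axis complex_vec_def)
qed simp

text \<open>Only boxes need checking. The preimage of a box is a rotated box, whose measure is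
  computed after moving to \<open>real^2\<close>, where the rotation is an orthogonal
  transformation.\<close>

lemma lborel_rotate:
  assumes w: "norm w = 1"
  shows "distr lborel borel ((*) w) = (lborel :: complex measure)"
proof (rule lborel_eqI[symmetric])
  have [measurable]: "vec_complex \<in> borel_measurable borel"
    by (rule borel_measurable_continuous_onI[OF continuous_on_vec_complex])
  have [measurable]: "(*) w \<in> borel_measurable borel"
    by (intro borel_measurable_continuous_onI continuous_intros)
  fix l u :: complex
  assume lu: "\<And>b. b \<in> Basis \<Longrightarrow> l \<bullet> b \<le> u \<bullet> b"
  have w0: "w \<noteq> 0" using w by auto
  \<comment> \<open>The inverse rotation seen in \<open>real^2\<close>: the preimage under
    multiplication by \<open>w\<close> becomes an image under \<open>f\<close>, to which invariance
    under orthogonal maps applies.\<close>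
  define f where "f = complex_vec \<circ> (*) (inverse w) \<circ> vec_complex"
  have "bounded_linear f"
    unfolding f_def o_def
    by (intro bounded_linear_compose[OF bounded_linear_complex_vec]
        bounded_linear_compose[OF bounded_linear_mult_right] bounded_linear_vec_complex)
  then have "orthogonal_transformation f"
    unfolding orthogonal_transformation
  proof (intro conjI allI bounded_linear.linear)
    fix v
    have "norm (f v) = norm (vec_complex v)"
      by (simp add: f_def norm_complex_vec norm_mult norm_inverse w)
    also have "\<dots> = norm v"
      using norm_complex_vec[of "vec_complex v"] by simp
    finally show "norm (f v) = norm v" .
  qed
  have S: "vec_complex -` box l u = box (complex_vec l) (complex_vec u)"
    by (auto simp: mem_box_cart forall_2 in_box_complex_iff vec_complex_def complex_vec_def)
  have Sm: "vec_complex -` box l u \<in> lmeasurable" unfolding S by simp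
  have im: "vec_complex -` ((*) w -` box l u) = f ` (vec_complex -` box l u)"
  proof (intro set_eqI iffI)
    fix x assume "x \<in> vec_complex -` ((*) w -` box l u)"
    then have "complex_vec (w * vec_complex x) \<in> vec_complex -` box l u" by simp
    moreover have "f (complex_vec (w * vec_complex x)) = x"
      by (simp add: f_def w0 flip: mult.assoc)
    ultimately show "x \<in> f ` (vec_complex -` box l u)" by (metis imageI)
  qed (auto simp: f_def w0 simp flip: mult.assoc)
  have wbox: "(*) w -` box l u \<in> sets borel"
    using measurable_sets[of "(*) w" borel borel "box l u"] by simp
  have meas: "vec_complex -` ((*) w -` box l u) \<in> sets borel"
    using measurable_sets_borel[of vec_complex borel, OF _ wbox] by simp
  have "emeasure (distr lborel borel ((*) w)) (box l u) = emeasure lborel ((*) w -` box l u)"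
    by (subst emeasure_distr) auto
  also have "\<dots> = emeasure (distr lborel borel vec_complex) ((*) w -` box l u)"
    by (simp add: lborel_vec_complex)
  also have "\<dots> = emeasure lborel (vec_complex -` ((*) w -` box l u))"
    by (subst emeasure_distr) (use wbox in auto)
  also have "\<dots> = emeasure lebesgue (f ` (vec_complex -` box l u))"
    using meas by (simp add: im)
  also have "\<dots> = emeasure lebesgue (vec_complex -` box l u)"
    using measure_orthogonal_image[OF \<open>orthogonal_transformation f\<close> Sm]
      measurable_orthogonal_image[OF \<open>orthogonal_transformation f\<close> Sm] Sm
    by (simp add: emeasure_eq_measure2 fmeasurableD2)
  also have "\<dots> = emeasure lborel (vec_complex -` box l u)"
    unfolding S by simp
  also have "\<dots> = emeasure (distr lborel borel vec_complex) (box l u)"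
    by (subst emeasure_distr) auto
  also have "\<dots> = (\<Prod>b\<in>Basis. (u - l) \<bullet> b)"
    using lu by (simp add: lborel_vec_complex emeasure_lborel_box)
  finally show "emeasure (distr lborel borel ((*) w)) (box l u) = (\<Prod>b\<in>Basis. (u - l) \<bullet> b)" .
qed simp

text \<open>Rotation by \<open>cis (pi / n)\<close> preserves the disc and multiplies
  \<open>x ^ n\<close> by -1, so the integral equals its own negative.\<close>

lemma integral_disc_power:
  fixes n :: nat
  assumes n: "0 < n"
  shows "(\<integral>x. indicator (ball 0 r) x *\<^sub>R x ^ n \<partial>lborel) = (0::complex)"
proof -
  define w where "w = cis (pi / n)"
  have nw: "norm w = 1" by (simp add: w_def)
  have wn: "w ^ n = -1" using n by (simp add: w_def Complex.DeMoivre cis_pi)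
  let ?f = "\<lambda>x::complex. indicator (ball 0 r) x *\<^sub>R x ^ n"
  have f[measurable]: "?f \<in> borel_measurable borel"
    by (intro borel_measurable_scaleR borel_measurable_indicator) auto
  have "(\<integral>x. ?f x \<partial>lborel) = (\<integral>x. ?f x \<partial>distr lborel borel ((*) w))"
    by (simp add: lborel_rotate nw)
  also have "\<dots> = (\<integral>x. ?f (w * x) \<partial>lborel)"
    by (rule integral_distr) (auto intro!: borel_measurable_continuous_onI continuous_intros)
  also have "\<dots> = (\<integral>x. - ?f x \<partial>lborel)"
    by (intro Bochner_Integration.integral_cong)
       (auto simp: indicator_def norm_mult nw power_mult_distrib wn)
  finally show ?thesis by (simp add: eq_neg_iff_add_eq_0)
qed

text \<open>Integrate the Taylor series term by term; rotation invariance kills all powers but the zeroth.\<close>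
lemma area_mean_value:
  fixes g :: "complex \<Rightarrow> complex"
  assumes hol: "g holomorphic_on ball z R" and r: "0 < r" "r < R"
  shows "integrable lborel (\<lambda>x. indicator (ball 0 r) x *\<^sub>R g (z + x))"
    and "(\<integral>x. indicator (ball 0 r) x *\<^sub>R g (z + x) \<partial>lborel) = (pi * r\<^sup>2) *\<^sub>R g z"
proof -
  define a where "a n = (deriv ^^ n) g z / fact n" for n
  have sums: "(\<lambda>n. a n * x ^ n) sums g (z + x)" if "norm x < R" for x
    using holomorphic_power_series[OF hol, of "z + x"] that by (simp add: a_def dist_norm)
  \<comment> \<open>An intermediate radius: convergence of the Taylor series at distance
    \<open>\<rho>\<close> from the centre forces absolute convergence at distance
    \<open>r\<close>.\<close>
  define \<rho> where "\<rho> = (r + R) / 2"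
  have \<rho>: "0 < \<rho>" "r < \<rho>" "\<rho> < R" using r by (auto simp: \<rho>_def)
  have "summable (\<lambda>n. a n * of_real \<rho> ^ n)"
    using sums[of "of_real \<rho>"] \<rho> by (simp add: sums_iff)
  then have summ: "summable (\<lambda>n. norm (a n * of_real r ^ n))"
    by (rule powser_insidea) (use r \<rho> in auto)
  \<comment> \<open>This constant dominates all partial sums on the disc of radius \<open>r\<close>,
    so dominated convergence applies.\<close>
  define B where "B = (\<Sum>n. norm (a n * of_real r ^ n))"
  define s where "s N x = indicator (ball 0 r) x *\<^sub>R (\<Sum>n<N. a n * x ^ n)" for N and x :: complex
  have s_meas: "s N \<in> borel_measurable lborel" for N
    unfolding s_def by (intro borel_measurable_scaleR borel_measurable_indicator) auto
  have lim: "(\<lambda>N. s N x) \<longlonglongrightarrow> indicator (ball 0 r) x *\<^sub>R g (z + x)" for x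
  proof (cases "norm x < r")
    case True
    then show ?thesis using sums[of x] r unfolding s_def sums_def by (intro tendsto_intros) auto
  qed (simp add: s_def)
  have g_meas: "(\<lambda>x. indicator (ball 0 r) x *\<^sub>R g (z + x)) \<in> borel_measurable lborel"
    by (rule borel_measurable_LIMSEQ_metric[OF s_meas lim])
  have dom: "integrable lborel (\<lambda>x. indicator (ball (0::complex) r) x *\<^sub>R B)"
    by (intro integrable_scaleR_left integrable_real_indicator) (use emeasure_lborel_ball_finite[of "0::complex" r] in auto)
  have bound: "norm (s N x) \<le> indicator (ball 0 r) x *\<^sub>R B" for N x
  proof (cases "norm x < r")
    case True
    have "norm (\<Sum>n<N. a n * x ^ n) \<le> (\<Sum>n<N. norm (a n * of_real r ^ n))"
      using True by (intro sum_norm_le) (auto simp: norm_mult norm_power intro!: mult_left_mono power_mono)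
    also have "\<dots> \<le> B" unfolding B_def by (rule sum_le_suminf[OF summ]) auto
    finally show ?thesis using True by (simp add: s_def)
  qed (simp add: s_def)
  show "integrable lborel (\<lambda>x. indicator (ball 0 r) x *\<^sub>R g (z + x))"
    by (rule integrable_dominated_convergence[where s = s, OF g_meas s_meas dom]) (intro AE_I2 lim bound)+
  have L: "(\<lambda>N. \<integral>x. s N x \<partial>lborel) \<longlonglongrightarrow> (\<integral>x. indicator (ball 0 r) x *\<^sub>R g (z + x) \<partial>lborel)"
    by (rule integral_dominated_convergence[where s = s, OF g_meas s_meas dom]) (intro AE_I2 lim bound)+
  have int_pow: "integrable lborel (\<lambda>x::complex. a n * (indicator (ball 0 r) x *\<^sub>R x ^ n))" for n
  proof (rule integrable_mult_right, rule Bochner_Integration.integrable_bound)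
    show "integrable lborel (\<lambda>x. indicator (ball (0::complex) r) x *\<^sub>R r ^ n)"
      by (intro integrable_scaleR_left integrable_real_indicator) (use emeasure_lborel_ball_finite[of "0::complex" r] in auto)
    show "(\<lambda>x::complex. indicator (ball 0 r) x *\<^sub>R x ^ n) \<in> borel_measurable lborel"
      by (intro borel_measurable_scaleR borel_measurable_indicator) auto
  qed (use r in \<open>auto simp: indicator_def norm_power intro!: AE_I2 power_mono\<close>)
  \<comment> \<open>From the first nonempty partial sum on, the integral no longer depends on
    \<open>N\<close>, as only the constant term contributes.\<close>
  have "(\<integral>x. s N x \<partial>lborel) = (pi * r\<^sup>2) *\<^sub>R g z" if "0 < N" for N
  proof -
    have "(\<integral>x. s N x \<partial>lborel) = (\<integral>x. (\<Sum>n<N. a n * (indicator (ball 0 r) x *\<^sub>R x ^ n)) \<partial>lborel)"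
      unfolding s_def by (intro Bochner_Integration.integral_cong) (auto simp: scaleR_sum_right)
    also have "\<dots> = (\<Sum>n<N. a n * (\<integral>x. indicator (ball 0 r) x *\<^sub>R x ^ n \<partial>lborel))"
      using int_pow by (simp del: mult_scaleR_right)
    also have "\<dots> = (\<Sum>n<N. if n = 0 then a 0 * of_real (measure lborel (ball (0::complex) r)) else 0)"
    proof (intro sum.cong refl)
      fix n
      have "(\<integral>x. indicator (ball (0::complex) r) x *\<^sub>R (1::complex) \<partial>lborel)
        = of_real (measure lborel (ball (0::complex) r))"
        by (subst integral_scaleR_left)
           (use emeasure_lborel_ball_finite[of "0::complex" r] in \<open>auto simp: scaleR_conv_of_real\<close>)
      then show "a n * (\<integral>x. indicator (ball 0 r) x *\<^sub>R x ^ n \<partial>lborel)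
        = (if n = 0 then a 0 * of_real (measure lborel (ball (0::complex) r)) else 0)"
        by (cases "n = 0") (simp_all del: mult_scaleR_right add: integral_disc_power)
    qed
    also have "\<dots> = (pi * r\<^sup>2) *\<^sub>R g z"
      using that r by (simp add: a_def content_ball unit_ball_vol_2 scaleR_conv_of_real mult.commute)
    finally show ?thesis .
  qed
  then have "(\<lambda>N. \<integral>x. s N x \<partial>lborel) \<longlonglongrightarrow> (pi * r\<^sup>2) *\<^sub>R g z"
    by (intro tendsto_eventually eventually_mono[OF eventually_gt_at_top[of 0]])
  with L show "(\<integral>x. indicator (ball 0 r) x *\<^sub>R g (z + x) \<partial>lborel) = (pi * r\<^sup>2) *\<^sub>R g z"
    by (rule LIMSEQ_unique)
qed

section \<open>Normalised area measure and the sub-mean value inequality\<close>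

lemma measurable_indicator_ball [measurable]:
  "(indicator (ball z r) :: complex \<Rightarrow> ennreal) \<in> borel_measurable borel"
  "(indicator (ball z r) :: complex \<Rightarrow> real) \<in> borel_measurable borel"
  by (intro borel_measurable_indicator; simp)+

lemma nn_integral_areaD:
  assumes [measurable]: "f \<in> borel_measurable borel"
  shows "(\<integral>\<^sup>+ z. f z \<partial>areaD) = (\<integral>\<^sup>+ z. ennreal (1 / pi) * (indicator (ball 0 1) z * f z) \<partial>lborel)"
  unfolding areaD_def
  by (subst nn_integral_density)
     (auto intro!: nn_integral_cong split: split_indicator)

lemma sets_areaD [measurable_cong]: "sets areaD = sets borel"
  by (simp add: areaD_def)

lemma space_areaD [simp]: "space areaD = UNIV"
  by (simp add: areaD_def)

lemma sigma_finite_areaD: "sigma_finite_measure areaD"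
proof (rule finite_measure.axioms(1), rule finite_measureI)
  have "emeasure areaD UNIV = (\<integral>\<^sup>+ z. ennreal (1 / pi) * indicator (ball (0::complex) 1) z \<partial>lborel)"
    using nn_integral_areaD[of "\<lambda>_. 1"] by (simp del: nn_integral_indicator nn_integral_cmult_indicator)
  also have "\<dots> = ennreal (1 / pi) * emeasure lborel (ball (0::complex) 1)"
    by (subst nn_integral_cmult) auto
  also have "\<dots> < \<infinity>"
    using emeasure_lborel_ball_finite[of "0::complex" 1] by (simp add: ennreal_mult_less_top)
  finally show "emeasure areaD (space areaD) \<noteq> \<infinity>" by simp
qed

text \<open>The normalisation by \<open>pi\<close> gives a full ball mass \<open>r^2\<close>; parts
  of the ball outside the unit disc carry no mass, whence only an inequality.\<close>

lemma emeasure_areaD_ball_le: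
  assumes "0 \<le> r"
  shows "emeasure areaD (ball z r) \<le> ennreal (r\<^sup>2)"
proof -
  have "emeasure areaD (ball z r) = (\<integral>\<^sup>+ w. indicator (ball z r) w \<partial>areaD)"
    by simp
  also have "\<dots> = (\<integral>\<^sup>+ w. ennreal (1 / pi) * (indicator (ball 0 1) w * indicator (ball z r) w) \<partial>lborel)"
    by (subst nn_integral_areaD) auto
  also have "\<dots> \<le> (\<integral>\<^sup>+ w. ennreal (1 / pi) * indicator (ball z r) w \<partial>lborel)"
    by (intro nn_integral_mono) (auto split: split_indicator)
  also have "\<dots> = ennreal (1 / pi) * emeasure lborel (ball z r)"
    by (subst nn_integral_cmult) auto
  also have "\<dots> = ennreal (r\<^sup>2)"
    using assms by (simp add: emeasure_ball unit_ball_vol_2 flip: ennreal_mult)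
  finally show ?thesis .
qed

text \<open>Jensen's inequality by hand: \<open>P\<close> is minorised by its supporting line at
  \<open>|g z|\<close>, and the modulus by the real part of a multiple of \<open>g\<close>. The mean
  of the resulting affine expression over the disc is exactly \<open>P |g z|\<close> by the area
  mean value property.\<close>

lemma orlicz_submean_value:
  assumes P: "orlicz_fun P" and hol: "g holomorphic_on ball z R" and r: "0 < r" "r < R"
    and sub: "ball z r \<subseteq> ball 0 1" and gm: "g \<in> borel_measurable borel"
  shows "ennreal (r\<^sup>2 * P (norm (g z)))
    \<le> (\<integral>\<^sup>+ w. indicator (ball z r) w * ennreal (P (norm (g w))) \<partial>areaD)"
proof -
  note [measurable] = gm
  have [measurable]: "(\<lambda>w. P (norm (g w))) \<in> borel_measurable borel"
    by (rule orlicz_measurable[OF P]) auto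
  define a where "a = norm (g z)"
  obtain c where c: "0 \<le> c" "\<And>x. 0 \<le> x \<Longrightarrow> P a + c * (x - a) \<le> P x"
    by (rule orlicz_supporting_line[OF P, of a]) (auto simp: a_def)
  \<comment> \<open>The rotation taking \<open>g z\<close> to its modulus. When
    \<open>g z = 0\<close>, division by zero makes it 0, and both facts below still hold.\<close>
  define \<eta> where "\<eta> = of_real a / g z"
  have \<eta>: "\<eta> * g z = of_real a" "norm \<eta> \<le> 1"
    by (cases "g z = 0"; simp add: \<eta>_def a_def norm_divide)+
  \<comment> \<open>An affine function of the real part of \<open>\<eta> * g\<close>: its integral
    is known exactly, and it lies below \<open>P\<close> of the modulus.\<close>
  define L where "L x = indicator (ball 0 r) x * (P a + c * (Re (\<eta> * g (z + x)) - a))" for x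
  let ?G = "\<lambda>x. indicator (ball 0 r) x *\<^sub>R g (z + x)"
  note G = area_mean_value[OF hol r]
  have ball_int: "integrable lborel (indicator (ball (0::complex) r) :: complex \<Rightarrow> real)"
    by (intro integrable_real_indicator) (use emeasure_lborel_ball_finite[of "0::complex" r] in auto)
  have L_eq: "L = (\<lambda>x. indicator (ball 0 r) x * (P a - c * a) + c * Re (\<eta> * ?G x))"
    by (auto simp: L_def fun_eq_iff algebra_simps split: split_indicator)
  have int_Re: "integrable lborel (\<lambda>x. Re (\<eta> * ?G x))"
    by (rule integrable_Re[OF integrable_mult_right[OF G(1)]])
  have L_int: "integrable lborel L"
    unfolding L_eq
    by (rule Bochner_Integration.integrable_add[OF integrable_mult_left[OF ball_int] integrable_mult_right[OF int_Re]])
  have "(\<integral>x. Re (\<eta> * ?G x) \<partial>lborel) = Re (\<eta> * ((pi * r\<^sup>2) *\<^sub>R g z))"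
    using integral_Re[OF integrable_mult_right[OF G(1), of \<eta>]]
    by (simp only: integral_mult_right_zero G(2))
  also have "\<dots> = pi * r\<^sup>2 * a"
    using \<eta> by (simp add: mult.left_commute)
  finally have "(\<integral>x. L x \<partial>lborel) = pi * r\<^sup>2 * (P a - c * a) + c * (pi * r\<^sup>2 * a)"
    unfolding L_eq using r
    by (subst Bochner_Integration.integral_add[OF integrable_mult_left[OF ball_int] integrable_mult_right[OF int_Re]])
       (simp add: content_ball unit_ball_vol_2)
  then have L_val: "(\<integral>x. L x \<partial>lborel) = pi * r\<^sup>2 * P a"
    by (simp add: algebra_simps)
  have L_le: "L x \<le> indicator (ball 0 r) x * P (norm (g (z + x)))" for x
  proof (cases "norm x < r")
    case True
    have "Re (\<eta> * g (z + x)) \<le> norm \<eta> * norm (g (z + x))"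
      using complex_Re_le_cmod norm_mult by metis
    also have "\<dots> \<le> 1 * norm (g (z + x))"
      using \<eta> by (intro mult_right_mono) auto
    finally have "P a + c * (Re (\<eta> * g (z + x)) - a) \<le> P a + c * (norm (g (z + x)) - a)"
      using c(1) by (intro add_left_mono mult_left_mono) auto
    also have "\<dots> \<le> P (norm (g (z + x)))" using c(2) by simp
    finally show ?thesis using True by (simp add: L_def)
  qed (simp add: L_def)
  \<comment> \<open>\<open>L\<close> may be negative, so its positive part is taken before passing
    to the nonnegative integral.\<close>
  have "pi * r\<^sup>2 * P a \<le> (\<integral>x. max 0 (L x) \<partial>lborel)"
    unfolding L_val[symmetric] using L_int by (intro integral_mono) auto
  then have "ennreal (pi * r\<^sup>2 * P a) \<le> ennreal (\<integral>x. max 0 (L x) \<partial>lborel)"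
    by (rule ennreal_leI)
  also have "\<dots> = (\<integral>\<^sup>+ x. ennreal (max 0 (L x)) \<partial>lborel)"
    using L_int by (intro nn_integral_eq_integral[symmetric]) auto
  also have "\<dots> \<le> (\<integral>\<^sup>+ x. indicator (ball z r) (z + x) * ennreal (P (norm (g (z + x)))) \<partial>lborel)"
  proof (intro nn_integral_mono)
    fix x
    show "ennreal (max 0 (L x)) \<le> indicator (ball z r) (z + x) * ennreal (P (norm (g (z + x))))"
      using L_le[of x] orlicz_nonneg[OF P, of "norm (g (z + x))"]
      by (auto simp: indicator_def L_def dist_norm intro!: ennreal_leI)
  qed
  also have "\<dots> = (\<integral>\<^sup>+ w. indicator (ball z r) w * ennreal (P (norm (g w))) \<partial>distr lborel borel ((+) z))"
    by (subst nn_integral_distr) auto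
  also have "\<dots> = (\<integral>\<^sup>+ w. indicator (ball z r) w * ennreal (P (norm (g w))) \<partial>lborel)"
    by (simp add: lborel_distr_plus)
  finally have *: "ennreal (pi * r\<^sup>2 * P a) \<le> \<dots>" .
  have "ennreal (r\<^sup>2 * P (norm (g z))) = ennreal (1 / pi) * ennreal (pi * r\<^sup>2 * P a)"
    using orlicz_nonneg[OF P, of a] by (simp add: a_def flip: ennreal_mult)
  also have "\<dots> \<le> ennreal (1 / pi) * (\<integral>\<^sup>+ w. indicator (ball z r) w * ennreal (P (norm (g w))) \<partial>lborel)"
    using * by (intro mult_left_mono) auto
  also have "\<dots> = (\<integral>\<^sup>+ w. ennreal (1 / pi) * (indicator (ball z r) w * ennreal (P (norm (g w)))) \<partial>lborel)"
    by (subst nn_integral_cmult) auto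
  also have "\<dots> = (\<integral>\<^sup>+ w. indicator (ball z r) w * ennreal (P (norm (g w))) \<partial>areaD)"
    using sub by (subst nn_integral_areaD) (auto intro!: nn_integral_cong split: split_indicator)
  finally show ?thesis .
qed

section \<open>Windows and the Carleson estimate\<close>

text \<open>Cosine is strictly decreasing on \<open>[0, pi]\<close>. The right-hand side is a closed
  condition, whereas \<open>Arg\<close> jumps across the negative axis.\<close>

lemma Arg_abs_le_iff:
  assumes "z \<noteq> 0" "0 \<le> a" "a \<le> pi"
  shows "\<bar>Arg z\<bar> \<le> a \<longleftrightarrow> norm z * cos a \<le> Re z"
proof -
  have "Re z = norm z * cos (Arg z)"
    using assms by (subst Arg_eq[OF assms(1)]) (simp add: exp_Euler cos_of_real sin_of_real flip: of_real_mult)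
  also have "cos (Arg z) = cos \<bar>Arg z\<bar>" by (simp add: abs_if)
  finally have "Re z = norm z * cos \<bar>Arg z\<bar>" .
  moreover have "\<bar>Arg z\<bar> \<le> a \<longleftrightarrow> cos a \<le> cos \<bar>Arg z\<bar>"
    using assms Arg_bounded[of z] by (intro cos_mono_le_eq[symmetric]) auto
  ultimately show ?thesis
    using assms by simp
qed

text \<open>For \<open>h < 1\<close> the window avoids the origin, so the angular condition can be
  made closed; this form shows that windows are Borel.\<close>

lemma window_eq:
  assumes "norm xi = 1" "0 < h" "h < 1"
  shows "window xi h = ball 0 1 \<inter> {z. 1 - h \<le> norm z} \<inter> {z. norm z * cos (pi * h) \<le> Re (z * cnj xi)}"
proof -
  have "\<bar>Arg (z * cnj xi)\<bar> \<le> pi * h \<longleftrightarrow> norm z * cos (pi * h) \<le> Re (z * cnj xi)" if "1 - h \<le> norm z" for z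
    using assms that by (subst Arg_abs_le_iff) (auto simp: norm_mult)
  then show ?thesis by (auto simp: window_def)
qed

lemma window_measurable:
  assumes "norm xi = 1" "0 < h" "h < 1"
  shows "window xi h \<in> sets borel"
  unfolding window_eq[OF assms]
  by (intro sets.Int borel_open borel_closed closed_Collect_le continuous_intros) auto

lemma abs_Arg_le:
  assumes "0 < Re z"
  shows "\<bar>Arg z\<bar> \<le> \<bar>Im z\<bar> / Re z"
proof -
  have "Arg z = arctan (Im z / Re z)" using assms by (rule arg_conv_arctan)
  also have "\<bar>\<dots>\<bar> \<le> \<bar>Im z / Re z\<bar>" by (rule abs_arctan_le)
  finally show ?thesis using assms by simp
qed

text \<open>With \<open>t = 1 - |z|\<close> and \<open>u = 1 - |w|\<close>, the condition says that \<open>w\<close> lies in the disc of radius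
  \<open>t/2\<close> about \<open>z\<close>; then \<open>2u/3 \<le> t \<le> 2u\<close>.\<close>
lemma near_point_in_window:
  assumes z: "7/8 \<le> norm z" "norm z < 1" and zw: "dist z w < (1 - norm z) / 2"
  shows "z \<in> window (sgn w) (2 * (1 - norm w))"
proof -
  define t u where "t = 1 - norm z" and "u = 1 - norm w"
  have tw: "\<bar>norm z - norm w\<bar> < t / 2"
    using zw norm_triangle_ineq3[of z w] by (simp add: dist_norm t_def)
  then have "norm z - norm w < t / 2" "norm w - norm z < t / 2" by linarith+
  then have tu: "t \<le> 2 * u" "2 * u \<le> 3 * t" by (auto simp: t_def u_def)
  have t: "0 < t" "t \<le> 1/8" using z by (auto simp: t_def)
  have w0: "w \<noteq> 0" using t tu by (auto simp: u_def)
  \<comment> \<open>Rotating by the direction of \<open>w\<close> moves \<open>w\<close> to the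
    positive real axis, so that \<open>Re v\<close> is close to \<open>norm w\<close> and
    \<open>Im v\<close> is small.\<close>
  define v where "v = z * cnj (sgn w)"
  have "w * cnj (sgn w) = w * cnj w / of_real (norm w)"
    by (simp add: sgn_eq)
  also have "\<dots> = of_real ((norm w)\<^sup>2) / of_real (norm w)"
    by (simp only: complex_norm_square)
  also have "\<dots> = of_real (norm w)"
    using w0 by (simp add: power2_eq_square)
  finally have "v - of_real (norm w) = (z - w) * cnj (sgn w)"
    by (simp add: v_def algebra_simps)
  then have d: "norm (v - of_real (norm w)) < t / 2"
    using zw w0 by (simp add: norm_mult norm_sgn dist_norm t_def)
  have im: "\<bar>Im v\<bar> < t / 2"
    using abs_Im_le_cmod[of "v - of_real (norm w)"] d by simp
  have "\<bar>Re v - norm w\<bar> < t / 2"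
    using abs_Re_le_cmod[of "v - of_real (norm w)"] d by simp
  then have "norm w - t / 2 < Re v" by linarith
  then have re: "1 / 2 \<le> Re v"
    using tu t by (simp add: u_def)
  have "\<bar>Arg v\<bar> \<le> \<bar>Im v\<bar> / Re v" using re by (intro abs_Arg_le) auto
  also have "\<dots> \<le> (t / 2) / (1 / 2)" using im re by (intro frac_le) auto
  also have "\<dots> \<le> 1 * (2 * u)" using tu by simp
  also have "\<dots> \<le> pi * (2 * u)" using tu t pi_gt3 by (intro mult_right_mono) auto
  finally show ?thesis
    using z tu by (simp add: window_def v_def t_def u_def)
qed

text \<open>A finite measure on the disc, encoded as a Borel measure on the whole plane that does
  not charge the complement of the disc.\<close>

locale disc_measure = finite_measure mu for mu :: "complex measure" +
  assumes sets_mu: "sets mu = sets borel" and null_outside: "emeasure mu (- ball 0 1) = 0"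
begin

lemma sets_mu_cong [measurable_cong]: "sets mu = sets borel"
  by (rule sets_mu)

lemma space_mu [simp]: "space mu = UNIV"
  using sets_eq_imp_space_eq[OF sets_mu] by simp

lemma bdd_above_measure_window: "bdd_above ((\<lambda>xi. measure mu (window xi h)) ` A)"
  by (rule bdd_aboveI2[where M = "measure mu (space mu)"]) (rule bounded_measure)

lemma measure_window_le_rho: "norm xi = 1 \<Longrightarrow> measure mu (window xi h) \<le> rho mu h"
  unfolding rho_def by (rule cSUP_upper[OF _ bdd_above_measure_window]) auto

lemma rho_nonneg: "0 \<le> rho mu h"
  by (rule order_trans[OF measure_nonneg measure_window_le_rho[of 1]]) simp

text \<open>The supremum itself need not be attained; a window with more than half of it is enough,
  since convexity absorbs the factor 2 later.\<close>

lemma rho_attained: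
  assumes "0 < rho mu h"
  obtains xi where "norm xi = 1" "rho mu h / 2 < measure mu (window xi h)"
proof -
  have "rho mu h / 2 < (SUP xi \<in> sphere 0 1. measure mu (window xi h))"
    using assms by (simp add: rho_def)
  then obtain xi where "xi \<in> sphere 0 1" "rho mu h / 2 < measure mu (window xi h)"
    by (subst (asm) less_cSUP_iff[OF _ bdd_above_measure_window]) auto
  then show ?thesis using that by simp
qed

lemma K2_nonneg: "0 < h \<Longrightarrow> 0 \<le> K2 mu h"
  unfolding K2_def by (rule SUP_upper2[of "h / 2"]) (auto simp: rho_nonneg)

text \<open>\<open>F z\<close> is at most an average of \<open>f\<close> over the disc about
  \<open>z\<close>. After interchanging the integrals, for fixed \<open>w\<close> the contributing
  points \<open>z\<close> lie in one window around the direction of \<open>w\<close>, and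
  \<open>Rrho\<close> bounds \<open>R\<close> times the measure of that window.\<close>

lemma carleson_estimate:
  fixes R :: "complex \<Rightarrow> real" and f :: "complex \<Rightarrow> ennreal"
  assumes Rm [measurable]: "R \<in> borel_measurable borel" and fm [measurable]: "f \<in> borel_measurable borel"
    and R0: "\<And>z. 0 \<le> R z"
    and Rsupp: "\<And>z. R z \<noteq> 0 \<Longrightarrow> 7/8 \<le> norm z \<and> norm z < 1"
    and Rrho: "\<And>z t. 0 < t \<Longrightarrow> t < 4 * (1 - norm z) \<Longrightarrow> R z * rho mu t \<le> e * t\<^sup>2"
    and sub: "\<And>z. R z \<noteq> 0 \<Longrightarrow> ennreal (((1 - norm z) / 2)\<^sup>2) * F z
        \<le> (\<integral>\<^sup>+ w. indicator (ball z ((1 - norm z) / 2)) w * f w \<partial>areaD)"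
    and e: "0 \<le> e"
  shows "(\<integral>\<^sup>+ z. ennreal (R z) * F z \<partial>mu) \<le> ennreal (36 * e) * (\<integral>\<^sup>+ w. f w \<partial>areaD)"
proof -
  \<comment> \<open>\<open>S\<close> relates \<open>z\<close> to the points \<open>w\<close> of the
    disc of radius \<open>(1 - |z|)/2\<close> about it; \<open>N\<close> below combines the weight
    \<open>R\<close> with the reciprocal of the squared radius.\<close>
  define S where "S = {p :: complex \<times> complex. dist (fst p) (snd p) < (1 - norm (fst p)) / 2}"
  define N where "N = (\<lambda>z. R z * (4 / (1 - norm z)\<^sup>2))"
  have N0: "0 \<le> N z" for z by (simp add: N_def R0)
  have [measurable]: "N \<in> borel_measurable borel" unfolding N_def by measurable
  have [measurable]: "S \<in> sets (borel \<Otimes>\<^sub>M borel)"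
  proof -
    have "{p \<in> space (borel \<Otimes>\<^sub>M borel). dist (fst p) (snd p) < (1 - norm (fst p)) / (2::real)}
        \<in> sets (borel \<Otimes>\<^sub>M (borel :: complex measure))"
      by measurable
    then show ?thesis by (simp add: S_def space_pair_measure)
  qed
  interpret A: sigma_finite_measure areaD by (rule sigma_finite_areaD)
  interpret pair_sigma_finite mu areaD ..
  have "(\<integral>\<^sup>+ z. ennreal (R z) * F z \<partial>mu)
      \<le> (\<integral>\<^sup>+ z. \<integral>\<^sup>+ w. ennreal (N z) * (indicator S (z, w) * f w) \<partial>areaD \<partial>mu)"
  proof (rule nn_integral_mono)
    fix z
    show "ennreal (R z) * F z \<le> (\<integral>\<^sup>+ w. ennreal (N z) * (indicator S (z, w) * f w) \<partial>areaD)"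
    proof (cases "R z = 0")
      case False
      have t: "0 < 1 - norm z" using Rsupp[OF False] by simp
      have "ennreal (R z) * F z = ennreal (N z) * (ennreal (((1 - norm z) / 2)\<^sup>2) * F z)"
        using t by (simp add: N_def R0 power_divide mult.assoc[symmetric] flip: ennreal_mult)
      also have "\<dots> \<le> ennreal (N z) * (\<integral>\<^sup>+ w. indicator (ball z ((1 - norm z) / 2)) w * f w \<partial>areaD)"
        by (intro mult_left_mono sub False) auto
      also have "\<dots> = (\<integral>\<^sup>+ w. ennreal (N z) * (indicator (ball z ((1 - norm z) / 2)) w * f w) \<partial>areaD)"
        by (rule nn_integral_cmult[symmetric]) measurable
      also have "\<dots> = (\<integral>\<^sup>+ w. ennreal (N z) * (indicator S (z, w) * f w) \<partial>areaD)"
        by (intro nn_integral_cong) (auto simp: S_def indicator_def)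
      finally show ?thesis .
    qed simp
  qed
  also have "\<dots> = (\<integral>\<^sup>+ w. \<integral>\<^sup>+ z. ennreal (N z) * (indicator S (z, w) * f w) \<partial>mu \<partial>areaD)"
    by (rule Fubini'[symmetric]) measurable
  also have "\<dots> \<le> (\<integral>\<^sup>+ w. ennreal (36 * e) * f w \<partial>areaD)"
  proof (rule nn_integral_mono)
    fix w
    \<comment> \<open>The section of \<open>S\<close> at \<open>w\<close>, restricted to points that
      carry weight.\<close>
    define T where "T = {z. (z, w) \<in> S \<and> R z \<noteq> 0}"
    have [measurable]: "T \<in> sets borel" unfolding T_def by measurable
    define m where "m = measure mu T"
    have *: "N z * m \<le> 36 * e" if "z \<in> T" for z
    proof -
      define t u where "t = 1 - norm z" and "u = 1 - norm w"
      have z: "7/8 \<le> norm z" "norm z < 1" and zw: "dist z w < t / 2"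
        using that Rsupp[of z] by (auto simp: T_def S_def t_def)
      have tw: "\<bar>norm z - norm w\<bar> < t / 2"
        using zw norm_triangle_ineq3[of z w] by (simp add: dist_norm)
      have t: "0 < t" "t \<le> 1/8" using z by (auto simp: t_def)
      have "norm z - norm w < t / 2" "norm w - norm z < t / 2" using tw by linarith+
      then have tu: "2 * u \<le> 3 * t" "t \<le> 2 * u" by (auto simp: t_def u_def)
      have w0: "w \<noteq> 0" using t tu by (auto simp: u_def)
      have "T \<subseteq> window (sgn w) (2 * u)"
        using near_point_in_window[of _ w] Rsupp by (auto simp: T_def S_def u_def)
      then have "m \<le> measure mu (window (sgn w) (2 * u))"
        unfolding m_def using t tu w0
        by (intro finite_measure_mono) (auto simp: sets_mu norm_sgn intro!: window_measurable)
      also have "\<dots> \<le> rho mu (2 * u)"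
        using w0 by (intro measure_window_le_rho) (simp add: norm_sgn)
      finally have "R z * m \<le> R z * rho mu (2 * u)"
        by (intro mult_left_mono R0)
      \<comment> \<open>\<open>Rrho\<close> is applicable at scale \<open>2 * u\<close>, since
        \<open>2 * u \<le> 3 * t < 4 * t\<close>. The constant 36 is then \<open>3^2\<close> times
        the 4 in \<open>N\<close>.\<close>
      also have "\<dots> \<le> e * (2 * u)\<^sup>2"
        using t tu by (intro Rrho) (auto simp: t_def)
      also have "\<dots> \<le> e * (3 * t)\<^sup>2"
        using t tu e by (intro mult_left_mono power_mono) auto
      finally have "R z * m * (4 / t\<^sup>2) \<le> e * (3 * t)\<^sup>2 * (4 / t\<^sup>2)"
        by (intro mult_right_mono) auto
      also have "\<dots> = 36 * e"
        using t by (simp add: power2_eq_square field_simps)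
      finally show ?thesis by (simp add: N_def t_def mult_ac)
    qed
    have "(\<integral>\<^sup>+ z. ennreal (N z) * (indicator S (z, w) * f w) \<partial>mu)
        = (\<integral>\<^sup>+ z. f w * (ennreal (N z) * indicator T z) \<partial>mu)"
      by (intro nn_integral_cong) (auto simp: T_def N_def indicator_def mult.commute)
    also have "\<dots> = f w * (\<integral>\<^sup>+ z. ennreal (N z) * indicator T z \<partial>mu)"
      by (rule nn_integral_cmult) measurable
    also have "(\<integral>\<^sup>+ z. ennreal (N z) * indicator T z \<partial>mu) \<le> ennreal (36 * e)"
    \<comment> \<open>The bound on \<open>N z * m\<close> is divided by \<open>m\<close> and
      integrated over \<open>T\<close>, of measure \<open>m\<close>; if \<open>m = 0\<close>, the
      integral is over a null set.\<close>
    proof (cases "m = 0")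
      case True
      then have "T \<in> null_sets mu"
        by (simp add: m_def null_sets_def sets_mu emeasure_eq_measure)
      then have "(\<integral>\<^sup>+ z. ennreal (N z) * indicator T z \<partial>mu) = 0"
        by (rule nn_integral_null_set)
      then show ?thesis by simp
    next
      case False
      then have m: "0 < m" by (simp add: m_def zero_less_measure_iff)
      have "(\<integral>\<^sup>+ z. ennreal (N z) * indicator T z \<partial>mu) \<le> (\<integral>\<^sup>+ z. ennreal (36 * e / m) * indicator T z \<partial>mu)"
        using * m by (intro nn_integral_mono) (auto simp: indicator_def field_simps intro!: ennreal_leI)
      also have "\<dots> = ennreal (36 * e / m) * ennreal m"
        by (simp add: m_def nn_integral_cmult_indicator sets_mu emeasure_eq_measure)
      also have "\<dots> = ennreal (36 * e)"
        using m e by (simp flip: ennreal_mult)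
      finally show ?thesis .
    qed
    finally show "(\<integral>\<^sup>+ z. ennreal (N z) * (indicator S (z, w) * f w) \<partial>mu) \<le> ennreal (36 * e) * f w"
      by (simp add: mult.commute mult_right_mono)
  qed
  also have "\<dots> = ennreal (36 * e) * (\<integral>\<^sup>+ w. f w \<partial>areaD)"
    by (rule nn_integral_cmult) measurable
  finally show ?thesis .
qed

end

section \<open>Growth of functions in the modular unit ball\<close>

lemma bergman_submean:
  assumes P: "orlicz_fun P" and hol: "g holomorphic_on ball 0 1" and gm: "g \<in> borel_measurable borel"
    and z: "norm z < 1"
  shows "ennreal (((1 - norm z) / 2)\<^sup>2) * ennreal (P (norm (g z)))
    \<le> (\<integral>\<^sup>+ w. indicator (ball z ((1 - norm z) / 2)) w * ennreal (P (norm (g w))) \<partial>areaD)"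
proof -
  have sub: "ball z (1 - norm z) \<subseteq> ball 0 1"
  proof
    fix w assume "w \<in> ball z (1 - norm z)"
    then show "w \<in> ball 0 1"
      using norm_triangle_ineq2[of w z] by (simp add: dist_norm norm_minus_commute)
  qed
  \<comment> \<open>Half the distance to the circle leaves room for the strictly larger disc of
    holomorphy that the mean value property requires.\<close>
  have "ball z ((1 - norm z) / 2) \<subseteq> ball z (1 - norm z)"
    using z by (intro subset_ball) auto
  with sub have sub': "ball z ((1 - norm z) / 2) \<subseteq> ball 0 1" by blast
  have "ennreal (((1 - norm z) / 2)\<^sup>2 * P (norm (g z)))
    \<le> (\<integral>\<^sup>+ w. indicator (ball z ((1 - norm z) / 2)) w * ennreal (P (norm (g w))) \<partial>areaD)"
    by (rule orlicz_submean_value[OF P holomorphic_on_subset[OF hol sub] _ _ sub' gm]) (use z in auto)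
  then show ?thesis by (simp add: ennreal_mult orlicz_nonneg[OF P])
qed

text \<open>The integral over the disc about \<open>z\<close> is at most the integral over the whole
  unit disc. This gives both the local bounds for Montel's theorem and the comparison of scales in
  the annulus estimate.\<close>

lemma bergman_pointwise_bound:
  assumes P: "orlicz_fun P" and hol: "g holomorphic_on ball 0 1" and gm: "g \<in> borel_measurable borel"
    and le1: "(\<integral>\<^sup>+ w. ennreal (P (norm (g w))) \<partial>areaD) \<le> 1"
    and z: "norm z < 1"
  shows "((1 - norm z) / 2)\<^sup>2 * P (norm (g z)) \<le> 1"
proof -
  have "ennreal (((1 - norm z) / 2)\<^sup>2 * P (norm (g z)))
      = ennreal (((1 - norm z) / 2)\<^sup>2) * ennreal (P (norm (g z)))"
    by (intro ennreal_mult) (auto simp: orlicz_nonneg[OF P])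
  also note bergman_submean[OF P hol gm z]
  also have "(\<integral>\<^sup>+ w. indicator (ball z ((1 - norm z) / 2)) w * ennreal (P (norm (g w))) \<partial>areaD)
      \<le> (\<integral>\<^sup>+ w. ennreal (P (norm (g w))) \<partial>areaD)"
    by (intro nn_integral_mono) (auto simp: indicator_def)
  also note le1
  finally show ?thesis by (simp add: ennreal_le_1)
qed

section \<open>Uniform smallness near the boundary circle\<close>

context disc_measure
begin

text \<open>Continuity from above: the decreasing sets \<open>A n\<close> intersect in the
  complement of the disc, which is a null set.\<close>

lemma measure_annulus_small:
  assumes "0 < e"
  obtains r where "7/8 \<le> r" "r < 1" "measure mu {z. r < norm z} < e"
proof -
  define A where "A n = {z::complex. 1 - 1 / real (Suc n) < norm z}" for n
  have [simp]: "A n \<in> sets mu" for n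
    unfolding A_def by (simp add: sets_mu)
  have "decseq A"
    unfolding decseq_Suc_iff
  proof
    fix n
    have "1 / real (Suc (Suc n)) \<le> 1 / real (Suc n)" by (intro frac_le) auto
    then show "A (Suc n) \<subseteq> A n" by (auto simp: A_def simp del: of_nat_Suc)
  qed
  then have "(\<lambda>n. measure mu (A n)) \<longlonglongrightarrow> measure mu (\<Inter>n. A n)"
    by (intro finite_Lim_measure_decseq) auto
  moreover have "(\<Inter>n. A n) = - ball 0 1"
  proof (intro set_eqI iffI)
    fix z assume "z \<in> (\<Inter>n. A n)"
    then have "1 - 1 / real (Suc n) \<le> norm z" for n by (auto simp: A_def less_imp_le)
    moreover have "(\<lambda>n. 1 - 1 / real (Suc n)) \<longlonglongrightarrow> 1 - 0"
      by (intro tendsto_intros LIMSEQ_Suc lim_1_over_n)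
    ultimately have "1 \<le> norm z" by (intro LIMSEQ_le_const2[of _ 1]) auto
    then show "z \<in> - ball 0 1" by simp
  next
    fix z :: complex assume z: "z \<in> - ball 0 1"
    have "z \<in> A n" for n
    proof -
      have "0 < 1 / real (Suc n)" "1 \<le> norm z" using z by auto
      then show ?thesis unfolding A_def mem_Collect_eq by linarith
    qed
    then show "z \<in> (\<Inter>n. A n)" by blast
  qed
  ultimately have "(\<lambda>n. measure mu (A n)) \<longlonglongrightarrow> 0"
    using null_outside by (simp add: measure_def)
  then have "\<forall>\<^sub>F n in sequentially. measure mu (A n) < e"
    using assms by (rule order_tendstoD)
  \<comment> \<open>The lower bound on \<open>n\<close> brings the radius above 7/8, the range in
    which the window geometry was established.\<close>
  then have "\<forall>\<^sub>F n in sequentially. measure mu (A n) < e \<and> 8 \<le> n"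
    using eventually_ge_at_top[of 8] by eventually_elim auto
  then obtain n where "measure mu (A n) < e" "8 \<le> n"
    using eventually_happens'[OF sequentially_bot] by blast
  then show ?thesis
    by (intro that[of "1 - 1 / real (Suc n)"]) (auto simp: A_def field_simps)
qed

text \<open>On the annulus, points with \<open>|g| \<le> sA\<close> contribute little because the
  annulus has small measure. The others are handled by the Carleson estimate with the weight
  \<open>P2 (a |g|) / P1 |g|\<close>. The radius is fixed before \<open>g\<close>, so the estimate
  is uniform.\<close>

lemma annulus_estimate:
  assumes P1: "orlicz_fun P1" and P2: "orlicz_fun P2"
    and hyp: "\<And>A. 0 < A \<Longrightarrow> \<exists>h0>0. \<forall>h\<in>{0<..<h0}. \<exists>k. (\<forall>t\<in>{0<..<h}. rho mu t \<le> k * t\<^sup>2)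
        \<and> k * h\<^sup>2 * P2 (A * orlicz_inv P1 (1 / h\<^sup>2)) \<le> 1"
    and a: "0 < a" and d: "0 < d"
  obtains r where "0 < r" "r < 1"
    "\<And>g. g holomorphic_on ball 0 1 \<Longrightarrow> (\<forall>z. z \<notin> ball 0 1 \<longrightarrow> g z = 0) \<Longrightarrow> g \<in> borel_measurable borel \<Longrightarrow>
      (\<integral>\<^sup>+ w. ennreal (P1 (norm (g w))) \<partial>areaD) \<le> 1 \<Longrightarrow>
      (\<integral>\<^sup>+ z. indicator {z. r < norm z} z * ennreal (P2 (a * norm (g z))) \<partial>mu) \<le> ennreal d"
proof -
  \<comment> \<open>The summand \<open>64 * a\<close> makes \<open>64 * a / A\<close> at most 1, as
    scaling requires; \<open>72 * a / d\<close> makes the Carleson constant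
    \<open>36 * a / A\<close> at most \<open>d / 2\<close>.\<close>
  define A where "A = 64 * a + 72 * a / d"
  have A: "0 < A" "64 * a \<le> A" "72 * a / d \<le> A" using a d by (auto simp: A_def add_pos_pos)
  obtain h0 where h0: "0 < h0" and hyp': "\<And>h. 0 < h \<Longrightarrow> h < h0 \<Longrightarrow>
      \<exists>k. (\<forall>t\<in>{0<..<h}. rho mu t \<le> k * t\<^sup>2) \<and> k * h\<^sup>2 * P2 (A * orlicz_inv P1 (1 / h\<^sup>2)) \<le> 1"
    using hyp[OF A(1)] by auto
  \<comment> \<open>The threshold is chosen so that a value \<open>s > sA\<close> has its scale
    \<open>8 / sqrt (P1 s)\<close> below \<open>h0\<close>.\<close>
  define sA where "sA = orlicz_inv P1 (64 / h0\<^sup>2)"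
  have sA: "0 \<le> sA" "P1 sA = 64 / h0\<^sup>2" using orlicz_inv[OF P1, of "64 / h0\<^sup>2"] by (auto simp: sA_def)
  have PsA: "0 \<le> P2 (a * sA)" using a sA by (intro orlicz_nonneg[OF P2]) auto
  obtain r where r: "7/8 \<le> r" "r < 1" "measure mu {z. r < norm z} < d / (2 * (1 + P2 (a * sA)))"
    by (rule measure_annulus_small[of "d / (2 * (1 + P2 (a * sA)))"]) (use d PsA in auto)
  have tail: "P2 (a * sA) * measure mu {z. r < norm z} \<le> d / 2"
  proof -
    have "P2 (a * sA) * measure mu {z. r < norm z} \<le> (1 + P2 (a * sA)) * (d / (2 * (1 + P2 (a * sA))))"
      using r PsA by (intro mult_mono) auto
    also have "\<dots> = d / 2" using PsA by (simp add: field_simps)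
    finally show ?thesis .
  qed
  show thesis
  proof (rule that[of r])
    fix g :: "complex \<Rightarrow> complex"
    assume hol: "g holomorphic_on ball 0 1" and out: "\<forall>z. z \<notin> ball 0 1 \<longrightarrow> g z = 0"
      and gm[measurable]: "g \<in> borel_measurable borel"
      and le1: "(\<integral>\<^sup>+ w. ennreal (P1 (norm (g w))) \<partial>areaD) \<le> 1"
    have [measurable]: "(\<lambda>z. P1 (norm (g z))) \<in> borel_measurable borel"
      by (rule orlicz_measurable[OF P1]) auto
    have [measurable]: "(\<lambda>z. P2 (a * norm (g z))) \<in> borel_measurable borel"
      by (rule orlicz_measurable[OF P2]) (use a in auto)
    \<comment> \<open>Multiplying this weight by \<open>P1 |g|\<close> recovers
      \<open>P2 (a |g|)\<close> on the part of the annulus where \<open>|g|\<close> is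
      large.\<close>
    define R where "R z = (if r < norm z \<and> norm z < 1 \<and> sA < norm (g z)
      then P2 (a * norm (g z)) / P1 (norm (g z)) else 0)" for z
    have Rm[measurable]: "R \<in> borel_measurable borel"
      unfolding R_def by measurable
    have R0: "0 \<le> R z" for z
      using a by (auto simp: R_def intro!: divide_nonneg_nonneg orlicz_nonneg[OF P1] orlicz_nonneg[OF P2])
    have Rrho: "R z * rho mu t \<le> a / A * t\<^sup>2" if t: "0 < t" "t < 4 * (1 - norm z)" for z t
    proof (cases "R z = 0")
      case True
      then show ?thesis using a A(1) by simp
    next
      case False
      define s where "s = norm (g z)"
      have z: "norm z < 1" and s: "sA < s" and Rz: "R z = P2 (a * s) / P1 s"
        using False by (auto simp: R_def s_def split: if_splits)
      have s0: "0 < s" using sA s by simp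
      have Ps0: "0 < P1 s" using s0 by (rule orlicz_pos[OF P1])
      \<comment> \<open>The scale attached to the value \<open>s\<close>, i.e.
        \<open>P1 s = 64 / h^2\<close>. The pointwise bound then says exactly that
        \<open>4 * (1 - |z|) \<le> h\<close>, so every admissible \<open>t\<close> is covered by the
        hypothesis at \<open>h\<close>.\<close>
      define h where "h = 8 / sqrt (P1 s)"
      have h: "0 < h" "h\<^sup>2 = 64 / P1 s" using Ps0 by (auto simp: h_def power_divide)
      have "64 / h0\<^sup>2 < P1 s"
        using orlicz_strict_mono[OF P1 sA(1) s] sA by simp
      then have "64 < P1 s * h0\<^sup>2" using h0 by (simp add: divide_less_eq)
      then have "h\<^sup>2 < h0\<^sup>2" using Ps0 by (simp add: h(2) divide_less_eq mult.commute)
      then have hh0: "h < h0" using h0 by (rule power2_less_imp_less[OF _ less_imp_le])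
      define x where "x = ((1 - norm z) / 2)\<^sup>2"
      have "x * P1 s \<le> 1"
        unfolding x_def s_def by (rule bergman_pointwise_bound[OF P1 hol gm le1 z])
      then have "64 * x \<le> h\<^sup>2"
        using Ps0 by (simp add: h(2) pos_le_divide_eq)
      moreover have "(4 * (1 - norm z))\<^sup>2 = 64 * x"
        unfolding x_def by (simp only: power_mult_distrib power_divide) simp
      ultimately have "(4 * (1 - norm z))\<^sup>2 \<le> h\<^sup>2" by simp
      then have "4 * (1 - norm z) \<le> h" using h(1) by (rule power2_le_imp_le[OF _ less_imp_le])
      then have th: "t < h" using t by simp
      obtain k where k: "\<forall>t\<in>{0<..<h}. rho mu t \<le> k * t\<^sup>2" "k * h\<^sup>2 * P2 (A * orlicz_inv P1 (1 / h\<^sup>2)) \<le> 1"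
        using hyp'[OF h(1) hh0] by auto
      have kt: "rho mu t \<le> k * t\<^sup>2" using k(1) t th by simp
      with rho_nonneg[of t] have "0 \<le> k * t\<^sup>2" by simp
      then have k0: "0 \<le> k" using t by (simp add: zero_le_mult_iff)
      \<comment> \<open>Convexity removes the factor 64 between \<open>P1 s\<close> and
        \<open>1 / h^2\<close>; the price is a factor 64 in the argument, which the size of
        \<open>A\<close> pays for.\<close>
      have "P1 (1/64 * s) \<le> 1/64 * P1 s" using s0 by (intro orlicz_scale[OF P1]) auto
      then have sle: "s / 64 \<le> orlicz_inv P1 (1 / h\<^sup>2)"
        using s0 Ps0 by (subst le_orlicz_inv_iff[OF P1]) (auto simp: h)
      have "P2 (64 * a / A * (A * (s / 64))) \<le> 64 * a / A * P2 (A * (s / 64))"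
        using a A(1,2) s0 by (intro orlicz_scale[OF P2]) auto
      also have "\<dots> \<le> 64 * a / A * P2 (A * orlicz_inv P1 (1 / h\<^sup>2))"
        using a A(1) s0 sle by (intro mult_left_mono orlicz_mono[OF P2]) auto
      finally have Pas: "P2 (a * s) \<le> 64 * a / A * P2 (A * orlicz_inv P1 (1 / h\<^sup>2))"
        using A(1) by simp
      have "R z * k = k * (h\<^sup>2 / 64) * P2 (a * s)"
        by (simp add: Rz h)
      also have "\<dots> \<le> k * (h\<^sup>2 / 64) * (64 * a / A * P2 (A * orlicz_inv P1 (1 / h\<^sup>2)))"
        using k0 by (intro mult_left_mono Pas) auto
      also have "\<dots> = a / A * (k * h\<^sup>2 * P2 (A * orlicz_inv P1 (1 / h\<^sup>2)))"
        by simp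
      also have "\<dots> \<le> a / A * 1"
        using a A(1) by (intro mult_left_mono k) auto
      finally have Rk: "R z * k \<le> a / A" by simp
      have "R z * rho mu t \<le> R z * k * t\<^sup>2"
        using mult_left_mono[OF kt R0[of z]] by (simp add: mult.assoc)
      also have "\<dots> \<le> a / A * t\<^sup>2" by (intro mult_right_mono Rk) auto
      finally show ?thesis .
    qed
    have "(\<integral>\<^sup>+ z. ennreal (R z) * ennreal (P1 (norm (g z))) \<partial>mu)
        \<le> ennreal (36 * (a / A)) * (\<integral>\<^sup>+ w. ennreal (P1 (norm (g w))) \<partial>areaD)"
    proof (rule carleson_estimate[OF Rm _ R0 _ Rrho])
      fix z assume "R z \<noteq> 0"
      then show "7/8 \<le> norm z \<and> norm z < 1" using r by (auto simp: R_def split: if_splits)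
      then show "ennreal (((1 - norm z) / 2)\<^sup>2) * ennreal (P1 (norm (g z)))
        \<le> (\<integral>\<^sup>+ w. indicator (ball z ((1 - norm z) / 2)) w * ennreal (P1 (norm (g w))) \<partial>areaD)"
        by (intro bergman_submean[OF P1 hol gm]) auto
    qed (use a A(1) in auto)
    also have "\<dots> \<le> ennreal (36 * (a / A)) * 1"
      by (intro mult_left_mono le1) auto
    also have "\<dots> \<le> ennreal (d / 2)"
      using A a d by (auto simp: field_simps intro!: ennreal_leI)
    finally have main: "(\<integral>\<^sup>+ z. ennreal (R z) * ennreal (P1 (norm (g z))) \<partial>mu) \<le> ennreal (d / 2)" .
    have "(\<integral>\<^sup>+ z. indicator {z. r < norm z} z * ennreal (P2 (a * norm (g z))) \<partial>mu)
      \<le> (\<integral>\<^sup>+ z. ennreal (P2 (a * sA)) * indicator {z. r < norm z} z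
           + ennreal (R z) * ennreal (P1 (norm (g z))) \<partial>mu)"
    proof (rule nn_integral_mono)
      fix z
      \<comment> \<open>Outside the annulus the left side vanishes; inside it, small values are
        covered by the first summand and large values by the second.\<close>
      consider "\<not> r < norm z" | "r < norm z" "norm (g z) \<le> sA" | "r < norm z" "sA < norm (g z)" by linarith
      then show "indicator {z. r < norm z} z * ennreal (P2 (a * norm (g z)))
        \<le> ennreal (P2 (a * sA)) * indicator {z. r < norm z} z + ennreal (R z) * ennreal (P1 (norm (g z)))"
      proof cases
        case 2
        then have "P2 (a * norm (g z)) \<le> P2 (a * sA)" using a by (intro orlicz_mono[OF P2]) auto
        then show ?thesis using 2 by (auto intro!: ennreal_leI add_increasing2)
      next
        case 3
        then have g0: "0 < norm (g z)" using sA by linarith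
        then have z: "norm z < 1" using out by force
        have "0 < P1 (norm (g z))" using g0 by (rule orlicz_pos[OF P1])
        then have "R z * P1 (norm (g z)) = P2 (a * norm (g z))"
          using 3 z by (simp add: R_def)
        then have "ennreal (R z) * ennreal (P1 (norm (g z))) = ennreal (P2 (a * norm (g z)))"
          using R0 by (simp add: orlicz_nonneg[OF P1] flip: ennreal_mult)
        then show ?thesis using 3 by simp
      qed simp
    qed
    also have "\<dots> = (\<integral>\<^sup>+ z. ennreal (P2 (a * sA)) * indicator {z. r < norm z} z \<partial>mu)
        + (\<integral>\<^sup>+ z. ennreal (R z) * ennreal (P1 (norm (g z))) \<partial>mu)"
      by (rule nn_integral_add) measurable
    also have "(\<integral>\<^sup>+ z. ennreal (P2 (a * sA)) * indicator {z. r < norm z} z \<partial>mu)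
        = ennreal (P2 (a * sA)) * ennreal (measure mu {z. r < norm z})"
      by (subst nn_integral_cmult_indicator) (auto simp: sets_mu emeasure_eq_measure)
    also have "\<dots> \<le> ennreal (d / 2)"
      using tail PsA by (simp flip: ennreal_mult) (rule ennreal_leI, simp)
    finally have "(\<integral>\<^sup>+ z. indicator {z. r < norm z} z * ennreal (P2 (a * norm (g z))) \<partial>mu)
       \<le> ennreal (d / 2) + ennreal (d / 2)"
      using main by (auto intro: order_trans add_mono)
    also have "\<dots> = ennreal d" using d by (simp flip: ennreal_plus)
    finally show "(\<integral>\<^sup>+ z. indicator {z. r < norm z} z * ennreal (P2 (a * norm (g z))) \<partial>mu) \<le> ennreal d" .
  qed (use r in auto)
qed

end

section \<open>Luxemburg norms and sufficiency\<close>

lemma modular_antimono: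
  assumes "orlicz_fun P" "0 < c" "c \<le> c'"
  shows "(\<integral>\<^sup>+ z. ennreal (P (norm (f z) / c')) \<partial>M) \<le> (\<integral>\<^sup>+ z. ennreal (P (norm (f z) / c)) \<partial>M)"
  using assms by (intro nn_integral_mono ennreal_leI orlicz_mono[of P]) (auto intro!: divide_left_mono)

text \<open>Strict inequality yields an admissible constant below \<open>c\<close>, so no attainment
  of the infimum is involved; the modular decreases as the constant grows.\<close>

lemma lux_norm_lessD:
  assumes P: "orlicz_fun P" and f: "in_orlicz M P f" and c: "lux_norm M P f < c"
  shows "0 < c" "(\<integral>\<^sup>+ z. ennreal (P (norm (f z) / c)) \<partial>M) \<le> 1"
proof -
  have "{C. C > 0 \<and> (\<integral>\<^sup>+ z. ennreal (P (norm (f z) / C)) \<partial>M) \<le> 1} \<noteq> {}"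
    using f by (auto simp: in_orlicz_def)
  then obtain C where C: "0 < C" "(\<integral>\<^sup>+ z. ennreal (P (norm (f z) / C)) \<partial>M) \<le> 1" "C < c"
    using cInf_lessD[OF _ c[unfolded lux_norm_def]] by blast
  then show "0 < c" by simp
  show "(\<integral>\<^sup>+ z. ennreal (P (norm (f z) / c)) \<partial>M) \<le> 1"
    using modular_antimono[OF P, of C c M f] C by (auto intro: order_trans)
qed

lemma lux_norm_bounds:
  assumes "0 < c" "(\<integral>\<^sup>+ z. ennreal (P (norm (f z) / c)) \<partial>M) \<le> 1"
  shows "0 \<le> lux_norm M P f" "lux_norm M P f \<le> c"
proof -
  show "0 \<le> lux_norm M P f"
    unfolding lux_norm_def by (rule cInf_greatest) (use assms in auto)
  show "lux_norm M P f \<le> c"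
    unfolding lux_norm_def by (rule cInf_lower) (use assms in \<open>auto intro!: bdd_belowI[of _ 0]\<close>)
qed

lemma tendsto_lux_norm_0:
  assumes "\<And>c. 0 < c \<Longrightarrow> \<forall>\<^sub>F n in F. (\<integral>\<^sup>+ z. ennreal (P (norm (f n z) / c)) \<partial>M) \<le> 1"
  shows "((\<lambda>n. lux_norm M P (f n)) \<longlongrightarrow> 0) F"
proof (rule tendstoI)
  fix e :: real assume e: "0 < e"
  \<comment> \<open>Halving \<open>e\<close> turns the weak bound on the norm into the strict one
    required.\<close>
  then have "\<forall>\<^sub>F n in F. (\<integral>\<^sup>+ z. ennreal (P (norm (f n z) / (e / 2))) \<partial>M) \<le> 1"
    by (intro assms) auto
  then show "\<forall>\<^sub>F n in F. dist (lux_norm M P (f n)) 0 < e"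
  proof eventually_elim
    case (elim n)
    then show ?case using lux_norm_bounds[OF _ elim] e by (simp add: dist_real_def)
  qed
qed

text \<open>A finite modular \<open>m\<close> is brought below 1 by enlarging the constant by the
  factor \<open>max 1 m\<close>, thanks to convexity.\<close>

lemma in_orlicz_if_finite:
  assumes P: "orlicz_fun P" and fm: "f \<in> borel_measurable M" and c: "0 < c"
    and fin: "(\<integral>\<^sup>+ z. ennreal (P (norm (f z) / c)) \<partial>M) < \<infinity>"
  shows "in_orlicz M P f"
proof -
  obtain m where m: "0 \<le> m" "(\<integral>\<^sup>+ z. ennreal (P (norm (f z) / c)) \<partial>M) = ennreal m"
    using fin by (cases "\<integral>\<^sup>+ z. ennreal (P (norm (f z) / c)) \<partial>M") auto
  define K where "K = max 1 m"
  have K: "1 \<le> K" "m \<le> K" by (auto simp: K_def)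
  have "(\<integral>\<^sup>+ z. ennreal (P (norm (f z) / (c * K))) \<partial>M)
      \<le> (\<integral>\<^sup>+ z. ennreal (1 / K) * ennreal (P (norm (f z) / c)) \<partial>M)"
  proof (rule nn_integral_mono)
    fix z
    have "P (1 / K * (norm (f z) / c)) \<le> 1 / K * P (norm (f z) / c)"
      using K c by (intro orlicz_scale[OF P]) auto
    also have "1 / K * (norm (f z) / c) = norm (f z) / (c * K)" by simp
    finally have "ennreal (P (norm (f z) / (c * K))) \<le> ennreal (1 / K * P (norm (f z) / c))"
      by (rule ennreal_leI)
    also have "\<dots> = ennreal (1 / K) * ennreal (P (norm (f z) / c))"
      using K c by (intro ennreal_mult orlicz_nonneg[OF P]) auto
    finally show "ennreal (P (norm (f z) / (c * K))) \<le> ennreal (1 / K) * ennreal (P (norm (f z) / c))" .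
  qed
  also have "\<dots> = ennreal (1 / K) * ennreal m"
    unfolding m(2)[symmetric]
    by (rule nn_integral_cmult)
       (rule measurable_compose[OF _ measurable_ennreal], rule orlicz_measurable[OF P], use fm c in auto)
  also have "\<dots> \<le> 1"
    using K m by (simp add: ennreal_le_1 flip: ennreal_mult)
  finally show ?thesis
    using fm c K by (auto simp: in_orlicz_def intro!: exI[of _ "c * K"])
qed

section \<open>Compactness by normal families\<close>

lemma compact_disc_subset:
  assumes "compact K" "K \<subseteq> ball (0::complex) 1"
  obtains r where "0 \<le> r" "r < 1" "K \<subseteq> cball 0 r"
proof (cases "K = {}")
  case True
  then show ?thesis using that[of 0] by auto
next
  case False
  then obtain x where "x \<in> K" "\<And>y. y \<in> K \<Longrightarrow> norm y \<le> norm x"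
    using continuous_attains_sup[OF assms(1) False, of norm] by (auto intro: continuous_intros)
  then have "K \<subseteq> cball 0 (norm x)" "norm x < 1" using assms(2) by auto
  then show ?thesis using that[of "norm x"] by simp
qed

context disc_measure
begin

text \<open>Montel's theorem gives a subsequence converging locally uniformly. Modulars of
  differences are small near the circle by the annulus estimate and small on the inner disc by
  uniform convergence. The hypothesis is the limit condition in elementary form.\<close>

lemma compact_embedding_sufficient:
  assumes P1: "orlicz_fun P1" and P2: "orlicz_fun P2"
    and hyp: "\<And>A. 0 < A \<Longrightarrow> \<exists>h0>0. \<forall>h\<in>{0<..<h0}. \<exists>k. (\<forall>t\<in>{0<..<h}. rho mu t \<le> k * t\<^sup>2)
        \<and> k * h\<^sup>2 * P2 (A * orlicz_inv P1 (1 / h\<^sup>2)) \<le> 1"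
  shows "compact_embedding mu P1 P2"
proof -
  note annulus = annulus_estimate[OF P1 P2 hyp]
  have meas_areaD: "borel_measurable areaD = borel_measurable borel"
    by (rule measurable_cong_sets) (auto simp: sets_areaD)
  have meas_mu: "borel_measurable mu = borel_measurable borel"
    by (rule measurable_cong_sets) (auto simp: sets_mu)
  \<comment> \<open>Splits a modular at radius \<open>r\<close>: an annulus part, and an inner part
    controlled by a bound \<open>B\<close> on the function.\<close>
  have modular_le: "(\<integral>\<^sup>+ z. ennreal (P2 (a * norm (g z))) \<partial>mu)
      \<le> (\<integral>\<^sup>+ z. indicator {z. r < norm z} z * ennreal (P2 (a * norm (g z))) \<partial>mu)
        + ennreal (P2 (a * B)) * emeasure mu UNIV"
    if "g \<in> borel_measurable borel" "0 < a" "\<And>z. norm z \<le> r \<Longrightarrow> norm (g z) \<le> B" for g :: "complex \<Rightarrow> complex" and a r B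
  proof -
    note [measurable] = that(1)
    have [measurable]: "(\<lambda>z. P2 (a * norm (g z))) \<in> borel_measurable borel"
      using that by (intro orlicz_measurable[OF P2]) auto
    have "(\<integral>\<^sup>+ z. ennreal (P2 (a * norm (g z))) \<partial>mu)
      \<le> (\<integral>\<^sup>+ z. indicator {z. r < norm z} z * ennreal (P2 (a * norm (g z))) + ennreal (P2 (a * B)) \<partial>mu)"
    proof (rule nn_integral_mono)
      fix z
      show "ennreal (P2 (a * norm (g z)))
        \<le> indicator {z. r < norm z} z * ennreal (P2 (a * norm (g z))) + ennreal (P2 (a * B))"
        using that(2) that(3)[of z]
        by (cases "r < norm z") (auto intro!: ennreal_leI orlicz_mono[OF P2] mult_left_mono)
    qed
    also have "\<dots> = (\<integral>\<^sup>+ z. indicator {z. r < norm z} z * ennreal (P2 (a * norm (g z))) \<partial>mu)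
        + (\<integral>\<^sup>+ z. ennreal (P2 (a * B)) \<partial>mu)"
      by (rule nn_integral_add) measurable
    finally show ?thesis by simp
  qed
  have well: "in_orlicz mu P2 f" if f_in: "f \<in> bergman_orlicz P1" for f
  proof -
    obtain C where C: "0 < C" "(\<integral>\<^sup>+ z. ennreal (P1 (norm (f z) / C)) \<partial>areaD) \<le> 1"
      and f: "f holomorphic_on ball 0 1" "\<And>z. z \<notin> ball 0 1 \<Longrightarrow> f z = 0" "f \<in> borel_measurable borel"
      using f_in by (auto simp: bergman_orlicz_def in_orlicz_def meas_areaD)
    define g where "g z = f z / of_real C" for z
    have g: "g holomorphic_on ball 0 1" "\<forall>z. z \<notin> ball 0 1 \<longrightarrow> g z = 0" "g \<in> borel_measurable borel"
      using f C unfolding g_def by (auto intro!: holomorphic_intros)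
    have ng: "norm (g z) = norm (f z) / C" for z using C by (simp add: g_def norm_divide)
    have g_mod: "(\<integral>\<^sup>+ w. ennreal (P1 (norm (g w))) \<partial>areaD) \<le> 1"
      using C by (simp add: ng)
    obtain r where r: "0 < r" "r < 1"
      "(\<integral>\<^sup>+ z. indicator {z. r < norm z} z * ennreal (P2 (1 * norm (g z))) \<partial>mu) \<le> ennreal 1"
      by (rule annulus[OF _ zero_less_one zero_less_one]) (use g g_mod in blast)+
    have "continuous_on (cball 0 r) g"
      using r g by (intro holomorphic_on_imp_continuous_on holomorphic_on_subset[OF g(1)]) auto
    then have "bounded (g ` cball 0 r)"
      by (intro compact_imp_bounded compact_continuous_image) auto
    then obtain B where "\<forall>z\<in>cball 0 r. norm (g z) \<le> B"
      by (auto simp: bounded_iff)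
    then have B: "norm (g z) \<le> B" if "norm z \<le> r" for z
      using that by simp
    have "(\<integral>\<^sup>+ z. ennreal (P2 (1 * norm (g z))) \<partial>mu) \<le> ennreal 1 + ennreal (P2 (1 * B)) * emeasure mu UNIV"
      using modular_le[OF g(3), of 1 r B] B r(3) by (auto intro: order_trans add_right_mono)
    also have "\<dots> < \<infinity>"
      by (simp add: ennreal_mult_less_top emeasure_eq_measure)
    finally show ?thesis
      using C f by (intro in_orlicz_if_finite[OF P2, of _ _ C]) (auto simp: ng meas_mu)
  qed
  moreover have "\<exists>r g. strict_mono r \<and> in_orlicz mu P2 g \<and>
      (\<lambda>n. lux_norm mu P2 (\<lambda>z. F (r n) z - g z)) \<longlonglongrightarrow> 0"
    if F: "\<And>n. F n \<in> bergman_orlicz P1 \<and> lux_norm areaD P1 (F n) \<le> C"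
    for F :: "nat \<Rightarrow> complex \<Rightarrow> complex" and C
  proof -
    \<comment> \<open>Positive and strictly above the norm bound, so that division by
      \<open>c\<close> puts the whole sequence into the modular unit ball.\<close>
    define c where "c = max C 0 + 1"
    have c: "0 < c" "C < c" by (auto simp: c_def)
    define H where "H = {g. g holomorphic_on ball 0 1 \<and> (\<forall>z. z \<notin> ball 0 1 \<longrightarrow> g z = 0)
      \<and> g \<in> borel_measurable borel \<and> (\<integral>\<^sup>+ w. ennreal (P1 (norm (g w))) \<partial>areaD) \<le> 1}"
    define G where "G n z = F n z / of_real c" for n z
    have GH: "G n \<in> H" for n
    proof -
      have "(\<integral>\<^sup>+ z. ennreal (P1 (norm (F n z) / c)) \<partial>areaD) \<le> 1"
        using F[of n] c by (intro lux_norm_lessD(2)[OF P1]) (auto simp: bergman_orlicz_def)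
      then show ?thesis
        using F[of n] c unfolding H_def G_def
        by (auto simp: bergman_orlicz_def in_orlicz_def meas_areaD norm_divide intro!: holomorphic_intros)
    qed
    have Gm: "G n \<in> borel_measurable borel" for n
      using GH[of n] by (simp add: H_def)
    have Gn: "(\<lambda>z. norm (G n z)) \<in> borel_measurable borel" for n
      using Gm[of n] by measurable
    have bnd: "\<exists>B. \<forall>h\<in>H. \<forall>z\<in>K. norm (h z) \<le> B" if K: "compact K" "K \<subseteq> ball 0 1" for K
    proof -
      obtain r where r: "0 \<le> r" "r < 1" "K \<subseteq> cball 0 r" using compact_disc_subset[OF K] .
      have "norm (h z) \<le> orlicz_inv P1 (1 / ((1 - r) / 2)\<^sup>2)" if h: "h \<in> H" and z: "z \<in> K" for h z
      proof (subst le_orlicz_inv_iff[OF P1])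
        have zr: "norm z \<le> r" using z r by auto
        have "((1 - r) / 2)\<^sup>2 * P1 (norm (h z)) \<le> ((1 - norm z) / 2)\<^sup>2 * P1 (norm (h z))"
          using zr r by (intro mult_right_mono power_mono) (auto simp: orlicz_nonneg[OF P1])
        also have "\<dots> \<le> 1"
          using h zr r by (intro bergman_pointwise_bound[OF P1]) (auto simp: H_def)
        finally show "P1 (norm (h z)) \<le> 1 / ((1 - r) / 2)\<^sup>2"
          using r by (simp add: pos_le_divide_eq mult.commute)
      qed auto
      then show ?thesis by blast
    qed
    obtain l s where l: "l holomorphic_on ball 0 1" and s: "strict_mono (s :: nat \<Rightarrow> nat)"
      and ptw: "\<And>x. x \<in> ball 0 1 \<Longrightarrow> (\<lambda>n. G (s n) x) \<longlonglongrightarrow> l x"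
      and unif: "\<And>K. compact K \<Longrightarrow> K \<subseteq> ball 0 1 \<Longrightarrow> uniform_limit K (G \<circ> s) l sequentially"
      by (rule Montel[of "ball 0 1" H G]) (use GH bnd in \<open>auto simp: H_def\<close>)
    \<comment> \<open>The limit is extended by 0, the convention for functions on the disc; this
      makes the convergence pointwise on the whole plane.\<close>
    define g where "g z = (if z \<in> ball 0 1 then l z else 0)" for z
    have ptw': "(\<lambda>n. G (s n) x) \<longlonglongrightarrow> g x" for x
    proof (cases "x \<in> ball 0 1")
      case True
      then show ?thesis using ptw[of x] by (simp only: g_def if_True)
    next
      case False
      then have "G (s n) x = 0" for n using GH[of "s n"] by (auto simp: H_def)
      then show ?thesis using False by (simp add: g_def)
    qed
    have gm: "g \<in> borel_measurable borel"
      by (rule borel_measurable_LIMSEQ_metric[OF _ ptw']) (use GH in \<open>auto simp: H_def\<close>)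
    have g_out: "g z = 0" if "\<not> norm z < 1" for z
      using that by (simp add: g_def)
    have g_hol: "g holomorphic_on ball 0 1"
      by (rule holomorphic_transform[OF l]) (simp add: g_def)
    \<comment> \<open>Fatou's lemma keeps the limit in the modular unit ball.\<close>
    have "(\<integral>\<^sup>+ w. ennreal (P1 (norm (g w))) \<partial>areaD)
      = (\<integral>\<^sup>+ w. liminf (\<lambda>n. ennreal (P1 (norm (G (s n) w)))) \<partial>areaD)"
    proof (rule nn_integral_cong)
      fix w
      have "(\<lambda>n. P1 (norm (G (s n) w))) \<longlonglongrightarrow> P1 (norm (g w))"
        by (rule continuous_on_tendsto_compose[OF orlicz_continuous_on[OF P1]])
           (auto intro!: tendsto_norm ptw')
      then have "(\<lambda>n. ennreal (P1 (norm (G (s n) w)))) \<longlonglongrightarrow> ennreal (P1 (norm (g w)))"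
        by (rule tendsto_ennrealI)
      then show "ennreal (P1 (norm (g w))) = liminf (\<lambda>n. ennreal (P1 (norm (G (s n) w))))"
        by (intro lim_imp_Liminf[symmetric]) auto
    qed
    also have "\<dots> \<le> liminf (\<lambda>n. \<integral>\<^sup>+ w. ennreal (P1 (norm (G (s n) w))) \<partial>areaD)"
      by (intro nn_integral_liminf measurable_compose[OF _ measurable_ennreal] orlicz_measurable[OF P1])
         (simp_all add: meas_areaD Gn)
    also have "\<dots> \<le> 1"
      using GH by (intro Liminf_le) (auto simp: H_def)
    finally have g_mod: "(\<integral>\<^sup>+ w. ennreal (P1 (norm (g w))) \<partial>areaD) \<le> 1" .
    \<comment> \<open>Halving the difference keeps it in the modular unit ball by convexity, so the
      annulus estimate applies to all \<open>D n\<close> with one radius.\<close>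
    define D where "D n z = (G (s n) z - g z) / 2" for n z
    have D_hol: "D n holomorphic_on ball 0 1" "\<forall>z. z \<notin> ball 0 1 \<longrightarrow> D n z = 0" "D n \<in> borel_measurable borel" for n
    proof -
      show "D n holomorphic_on ball 0 1"
        using GH[of "s n"] g_hol unfolding D_def by (auto simp: H_def intro!: holomorphic_intros)
      show "\<forall>z. z \<notin> ball 0 1 \<longrightarrow> D n z = 0"
        using GH[of "s n"] by (simp add: H_def D_def g_def)
      show "D n \<in> borel_measurable borel"
        using Gm[of "s n"] gm unfolding D_def by measurable
    qed
    have D_mod: "(\<integral>\<^sup>+ w. ennreal (P1 (norm (D n w))) \<partial>areaD) \<le> 1" for n
    proof -
      have m: "(\<lambda>w. ennreal (P1 (norm (G (s n) w)))) \<in> borel_measurable areaD"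
        "(\<lambda>w. ennreal (P1 (norm (g w)))) \<in> borel_measurable areaD"
        using gm by (intro measurable_compose[OF _ measurable_ennreal] orlicz_measurable[OF P1];
            simp add: meas_areaD Gn)+
      have "(\<integral>\<^sup>+ w. ennreal (P1 (norm (D n w))) \<partial>areaD)
        \<le> (\<integral>\<^sup>+ w. ennreal (1/2) * (ennreal (P1 (norm (G (s n) w))) + ennreal (P1 (norm (g w)))) \<partial>areaD)"
      proof (rule nn_integral_mono)
        fix w
        have "norm (D n w) \<le> (1 - 1/2) * norm (G (s n) w) + 1/2 * norm (g w)"
          using norm_triangle_ineq4[of "G (s n) w" "g w"] by (simp add: D_def norm_divide)
        then have "P1 (norm (D n w)) \<le> P1 ((1 - 1/2) * norm (G (s n) w) + 1/2 * norm (g w))"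
          by (intro orlicz_mono[OF P1]) auto
        also have "\<dots> \<le> (1 - 1/2) * P1 (norm (G (s n) w)) + 1/2 * P1 (norm (g w))"
          by (intro orlicz_convexD[OF P1]) auto
        also have "\<dots> = 1/2 * (P1 (norm (G (s n) w)) + P1 (norm (g w)))" by (simp add: algebra_simps)
        finally have "ennreal (P1 (norm (D n w))) \<le> ennreal (1/2 * (P1 (norm (G (s n) w)) + P1 (norm (g w))))"
          by (rule ennreal_leI)
        also have "\<dots> = ennreal (1/2) * (ennreal (P1 (norm (G (s n) w))) + ennreal (P1 (norm (g w))))"
          by (subst ennreal_mult) (auto simp: orlicz_nonneg[OF P1] ennreal_plus add_nonneg_nonneg)
        finally show "ennreal (P1 (norm (D n w)))
          \<le> ennreal (1/2) * (ennreal (P1 (norm (G (s n) w))) + ennreal (P1 (norm (g w))))" .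
      qed
      also have "\<dots> = ennreal (1/2) * ((\<integral>\<^sup>+ w. ennreal (P1 (norm (G (s n) w))) \<partial>areaD)
          + (\<integral>\<^sup>+ w. ennreal (P1 (norm (g w))) \<partial>areaD))"
        using m by (subst nn_integral_cmult) (auto simp: nn_integral_add)
      also have "\<dots> \<le> ennreal (1/2) * (1 + 1)"
        using GH[of "s n"] g_mod by (intro mult_left_mono add_mono) (auto simp: H_def)
      also have "\<dots> = ennreal (1/2) * ennreal 2" by simp
      also have "\<dots> = ennreal (1/2 * 2)" by (rule ennreal_mult[symmetric]) auto
      also have "\<dots> = 1" by simp
      finally show ?thesis .
    qed
    have ev: "\<forall>\<^sub>F n in sequentially. (\<integral>\<^sup>+ z. ennreal (P2 (a * norm (D n z))) \<partial>mu) \<le> 1" if a: "0 < a" for a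
    proof -
      obtain r where r: "0 < r" "r < 1"
        "\<And>n. (\<integral>\<^sup>+ z. indicator {z. r < norm z} z * ennreal (P2 (a * norm (D n z))) \<partial>mu) \<le> ennreal (1/2)"
        by (rule annulus[OF _ a half_gt_zero_iff[THEN iffD2, OF zero_less_one]]) (use D_hol D_mod in blast)+
      \<comment> \<open>Chosen so that a bound \<open>B\<close> with \<open>P2 (a * B) = K\<close>
        leaves at most 1/2 for the inner disc, the other half being reserved for the annulus; adding
        1 to the total mass avoids division by 0.\<close>
      define K where "K = 1 / (2 * (1 + measure mu UNIV))"
      have K: "0 < K" by (auto simp: K_def add_pos_nonneg)
      define B where "B = orlicz_inv P2 K / a"
      have PB: "P2 (a * B) = K" using a K by (simp add: B_def orlicz_inv[OF P2])
      have B: "0 < B"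
        using PB K orlicz_zero[OF P2] orlicz_inv[OF P2, of K] a unfolding B_def
        by (metis divide_pos_pos less_eq_real_def)
      have "uniform_limit (cball 0 r) (G \<circ> s) l sequentially"
        using r by (intro unif) auto
      then have "\<forall>\<^sub>F n in sequentially. \<forall>z\<in>cball 0 r. dist ((G \<circ> s) n z) (l z) < B"
        using B by (auto simp: uniform_limit_iff)
      then show ?thesis
      proof eventually_elim
        case (elim n)
        have bd: "norm (D n z) \<le> B" if "norm z \<le> r" for z
        proof -
          have "dist (G (s n) z) (l z) < B" using elim that by simp
          then show ?thesis using that r(2) B by (simp add: D_def g_def dist_norm norm_divide)
        qed
        have "(\<integral>\<^sup>+ z. ennreal (P2 (a * norm (D n z))) \<partial>mu) \<le> ennreal (1/2) + ennreal (P2 (a * B)) * emeasure mu UNIV"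
          using modular_le[OF D_hol(3) a bd] r(3)[of n] by (auto intro: order_trans add_right_mono)
        also have "ennreal (P2 (a * B)) * emeasure mu UNIV = ennreal (K * measure mu UNIV)"
          using K by (simp add: PB emeasure_eq_measure ennreal_mult)
        also have "ennreal (1/2) + \<dots> = ennreal (1/2 + K * measure mu UNIV)"
          using K by (intro ennreal_plus[symmetric]) auto
        also have "\<dots> \<le> 1"
        proof -
          have "K * measure mu UNIV \<le> K * (1 + measure mu UNIV)" using K by simp
          also have "\<dots> = 1/2" using measure_nonneg[of mu UNIV] by (simp add: K_def field_simps del: measure_nonneg)
          finally show ?thesis by (simp add: ennreal_le_1)
        qed
        finally show ?case .
      qed
    qed
    have "(\<lambda>n. lux_norm mu P2 (\<lambda>z. F (s n) z - of_real c * g z)) \<longlonglongrightarrow> 0"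
    proof (rule tendsto_lux_norm_0)
      fix e :: real assume e: "0 < e"
      have "norm (F (s n) z - of_real c * g z) / e = 2 * c / e * norm (D n z)" for n z
      proof -
        have "F (s n) z - of_real c * g z = of_real (2 * c) * D n z"
          using c by (simp add: D_def G_def field_simps)
        then show ?thesis using c by (simp add: norm_mult)
      qed
      then show "\<forall>\<^sub>F n in sequentially. (\<integral>\<^sup>+ z. ennreal (P2 (norm (F (s n) z - of_real c * g z) / e)) \<partial>mu) \<le> 1"
        using ev[of "2 * c / e"] c e by simp
    qed
    \<comment> \<open>The limit is itself a Bergman-Orlicz function, so the well-definedness already
      proved applies to it.\<close>
    moreover have "in_orlicz mu P2 (\<lambda>z. of_real c * g z)"
    proof (rule well)
      have "(\<integral>\<^sup>+ w. ennreal (P1 (norm (of_real c * g w) / c)) \<partial>areaD) \<le> 1"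
        using g_mod c by (simp add: norm_mult)
      then show "(\<lambda>z. of_real c * g z) \<in> bergman_orlicz P1"
        using gm c g_hol g_out
        by (auto simp: bergman_orlicz_def in_orlicz_def meas_areaD intro!: holomorphic_intros)
    qed
    ultimately show ?thesis using s by blast
  qed
  ultimately show ?thesis unfolding compact_embedding_def by blast
qed

end

section \<open>Test functions and necessity\<close>

text \<open>A point with \<open>2 ^ (k - 1) * h \<le> dist \<le> 2 ^ k * h\<close> is charged to the \<open>k\<close>-th ball, of area at most \<open>4 ^ k * h\<^sup>2\<close>.\<close>
lemma nn_integral_areaD_inverse_fourth_power:
  fixes F :: "complex \<Rightarrow> real"
  assumes h: "0 < h" and F: "\<And>z. F z \<noteq> 0 \<Longrightarrow> h \<le> dist p z \<and> F z \<le> (h / dist p z) ^ 4"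
  shows "(\<integral>\<^sup>+ z. ennreal (F z) \<partial>areaD) \<le> ennreal (64 / 3 * h\<^sup>2)"
proof -
  have "(\<integral>\<^sup>+ z. ennreal (F z) \<partial>areaD)
    \<le> (\<integral>\<^sup>+ z. (\<Sum>k. ennreal (16 * (1/16) ^ k) * indicator (ball p (2 ^ k * h)) z) \<partial>areaD)"
  proof (rule nn_integral_mono)
    fix z
    show "ennreal (F z) \<le> (\<Sum>k. ennreal (16 * (1/16) ^ k) * indicator (ball p (2 ^ k * h)) z)"
    proof (cases "F z = 0")
      case False
      define d where "d = dist p z"
      have d: "h \<le> d" "F z \<le> (h / d) ^ 4" using F[OF False] by (auto simp: d_def)
      have sing: "sum G {k} = G k" for G :: "nat \<Rightarrow> ennreal" and k by simp
      \<comment> \<open>The least dyadic ball containing \<open>z\<close>. Since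
        \<open>d \<ge> h\<close>, its index is positive, and minimality at the predecessor gives
        \<open>h / d \<le> (1/2)^(k-1)\<close>; the fourth power accounts for the constant
        16.\<close>
      define k where "k = (LEAST k. d < 2 ^ k * h)"
      have "\<exists>k::nat. d / h < 2 ^ k" by (rule real_arch_pow) simp
      then have ex: "\<exists>k::nat. d < 2 ^ k * h" using h by (simp add: divide_less_eq)
      then have k: "d < 2 ^ k * h" unfolding k_def by (rule LeastI_ex)
      have "k \<noteq> 0"
      proof
        assume "k = 0"
        then show False using k d by simp
      qed
      then obtain j where j: "k = Suc j" by (cases k) auto
      have "\<not> d < 2 ^ j * h" using not_less_Least[of j "\<lambda>k. d < 2 ^ k * h"] j by (simp add: k_def)
      then have "h / d \<le> (1/2) ^ j" using h d by (simp add: field_simps power_divide)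
      then have "(h / d) ^ 4 \<le> ((1/2) ^ j) ^ 4" using h d by (intro power_mono) auto
      also have "((1/2) ^ j) ^ 4 = ((1/2 :: real) ^ 4) ^ j"
        by (simp only: power_mult[symmetric] mult.commute)
      also have "((1/2) ^ 4) ^ j = 16 * (1/16 :: real) ^ k" by (simp add: j power_divide)
      finally have "ennreal (F z) \<le> ennreal (16 * (1/16) ^ k) * indicator (ball p (2 ^ k * h)) z"
        using d k by (auto simp: d_def intro!: ennreal_leI)
      also have "\<dots> \<le> (\<Sum>k. ennreal (16 * (1/16) ^ k) * indicator (ball p (2 ^ k * h)) z)"
        using sum_le_suminf[of "\<lambda>k. ennreal (16 * (1/16) ^ k) * indicator (ball p (2 ^ k * h)) z" "{k}"]
        by (simp only: sing summableI finite.intros zero_le)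
      finally show ?thesis .
    qed simp
  qed
  also have "\<dots> = (\<Sum>k. \<integral>\<^sup>+ z. ennreal (16 * (1/16) ^ k) * indicator (ball p (2 ^ k * h)) z \<partial>areaD)"
    by (rule nn_integral_suminf) measurable
  also have "\<dots> \<le> (\<Sum>k. ennreal (16 * h\<^sup>2 * (1/4) ^ k))"
  proof (rule suminf_le)
    fix k :: nat
    have "(\<integral>\<^sup>+ z. ennreal (16 * (1/16) ^ k) * indicator (ball p (2 ^ k * h)) z \<partial>areaD)
      = ennreal (16 * (1/16) ^ k) * emeasure areaD (ball p (2 ^ k * h))"
      by (rule nn_integral_cmult_indicator) (simp add: sets_areaD)
    also have "\<dots> \<le> ennreal (16 * (1/16) ^ k) * ennreal ((2 ^ k * h)\<^sup>2)"
      using h by (intro mult_left_mono emeasure_areaD_ball_le) auto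
    also have "\<dots> = ennreal (16 * (1/16) ^ k * (2 ^ k * h)\<^sup>2)"
      by (rule ennreal_mult[symmetric]) auto
    \<comment> \<open>The area growth \<open>4^k\<close> against the decay \<open>16^(-k)\<close>
      leaves a geometric series of ratio 1/4, with total \<open>64/3 * h^2\<close>.\<close>
    also have "16 * (1/16) ^ k * (2 ^ k * h)\<^sup>2 = 16 * h\<^sup>2 * ((1/16) ^ k * 4 ^ k)"
      by (simp add: power_mult_distrib power2_eq_square flip: power_mult_distrib[of 2 2])
    also have "(1/16) ^ k * 4 ^ k = (1/4 :: real) ^ k"
      by (simp flip: power_mult_distrib)
    finally show "(\<integral>\<^sup>+ z. ennreal (16 * (1/16) ^ k) * indicator (ball p (2 ^ k * h)) z \<partial>areaD)
      \<le> ennreal (16 * h\<^sup>2 * (1/4) ^ k)" .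
  qed auto
  also have "\<dots> = ennreal (64 / 3 * h\<^sup>2)"
  proof (rule suminf_ennreal_eq)
    have "(\<lambda>k. 16 * h\<^sup>2 * (1/4) ^ k) sums (16 * h\<^sup>2 * (1 / (1 - 1/4)))"
      by (intro sums_mult geometric_sums) auto
    then show "(\<lambda>k. 16 * h\<^sup>2 * (1/4) ^ k) sums (64 / 3 * h\<^sup>2)" by (simp add: mult.commute)
  qed auto
  finally show ?thesis .
qed

text \<open>With \<open>v = z * cnj xi\<close>, the expression splits into a radial part
  \<open>1 - |v|\<close>, an angular part \<open>|v| * (1 - exp (i Arg v))\<close> and
  \<open>h * v\<close>, of sizes at most \<open>h\<close>, \<open>pi * h\<close> and
  \<open>h\<close>.\<close>

lemma norm_window_le:
  assumes xi: "norm xi = 1" and h: "0 < h" "h < 1" and z: "z \<in> window xi h"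
  shows "norm (1 - of_real (1 - h) * (cnj xi * z)) \<le> 6 * h"
proof -
  define v where "v = z * cnj xi"
  have nv: "norm v = norm z" by (simp add: v_def norm_mult xi)
  have v: "1 - h \<le> norm v" "norm v < 1" "\<bar>Arg v\<bar> \<le> pi * h"
    using z by (auto simp: window_def nv) (auto simp: v_def)
  have v0: "v \<noteq> 0" using v h by auto
  have "norm (exp (\<i> * of_real (Arg v)) - 1) \<le> \<bar>Arg v\<bar>"
    using abs_sin_x_le_abs_x[of "Arg v / 2"] by (simp add: dist_exp_i_1[of "Arg v"])
  then have e: "norm (1 - exp (\<i> * of_real (Arg v))) \<le> pi * h"
    using v by (simp add: norm_minus_commute)
  have "1 - of_real (1 - h) * v = of_real (1 - norm v)
      + of_real (norm v) * (1 - exp (\<i> * of_real (Arg v))) + of_real h * v"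
    using Arg_eq[OF v0] by (simp add: algebra_simps)
  also have "norm \<dots> \<le> norm (of_real (1 - norm v) :: complex)
      + norm (of_real (norm v) * (1 - exp (\<i> * of_real (Arg v)))) + norm (of_real h * v)"
    by (intro norm_triangle_le add_right_mono norm_triangle_ineq)
  also have "\<dots> \<le> h + pi * h + h"
  proof (intro add_mono)
    show "norm (of_real (1 - norm v) :: complex) \<le> h" using v by (simp only: norm_of_real)
    have "norm v * norm (1 - exp (\<i> * of_real (Arg v))) \<le> 1 * (pi * h)"
      using v e by (intro mult_mono) auto
    then show "norm (of_real (norm v) * (1 - exp (\<i> * of_real (Arg v)))) \<le> pi * h"
      by (simp add: norm_mult)
    show "norm (of_real h * v) \<le> h"
      using v h by (simp add: norm_mult mult_left_le)
  qed
  also have "\<dots> = (2 + pi) * h" by (simp add: algebra_simps)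
  also have "\<dots> \<le> 6 * h" using h pi_less_4 by (intro mult_right_mono) auto
  finally show ?thesis by (simp add: v_def mult.commute)
qed

text \<open>Up to the factor \<open>1 - h\<close>, the denominator \<open>D\<close> is the distance
  to a pole outside the disc, so the fourth power is integrated by dyadic balls. Scaling
  \<open>P\<close> by the fourth power then reduces the modular to that integral, and 86 is the
  constant that makes it at most 1.\<close>

lemma test_function:
  assumes P: "orlicz_fun P" and xi: "norm xi = 1" and h: "0 < h" "h \<le> 1/2"
  obtains f where "f \<in> bergman_orlicz P" "lux_norm areaD P f \<le> 1"
    "\<And>z. z \<in> window xi h \<Longrightarrow> orlicz_inv P (1 / h\<^sup>2) / (86 * 6 ^ 4) \<le> norm (f z)"
    "\<And>z. norm z < 1 \<Longrightarrow> norm (f z) \<le> orlicz_inv P (1 / h\<^sup>2) * (h / (1 - norm z)) ^ 4"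
proof -
  define c where "c = orlicz_inv P (1 / h\<^sup>2)"
  have c: "0 \<le> c" "P c = 1 / h\<^sup>2" by (auto simp: c_def orlicz_inv[OF P])
  define D where "D z = 1 - of_real (1 - h) * (cnj xi * z)" for z
  define f where "f z = (if z \<in> ball 0 1 then of_real (c / 86) * (of_real h / D z) ^ 4 else 0)" for z
  have D_ge: "1 - (1 - h) * norm z \<le> norm (D z)" for z
    using norm_triangle_ineq2[of 1 "of_real (1 - h) * (cnj xi * z)"] h
    by (simp add: D_def norm_mult xi del: of_real_diff)
  have D_ge_h: "h \<le> norm (D z)" and D_ge_1: "1 - norm z \<le> norm (D z)" if "norm z < 1" for z
  proof -
    have "(1 - h) * norm z \<le> (1 - h) * 1" using that h by (intro mult_left_mono) auto
    then show "h \<le> norm (D z)" using D_ge[of z] by simp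
    have "(1 - h) * norm z \<le> 1 * norm z" using h by (intro mult_right_mono) auto
    then show "1 - norm z \<le> norm (D z)" using D_ge[of z] by simp
  qed
  have D0: "D z \<noteq> 0" if "norm z < 1" for z using D_ge_h[OF that] h by auto
  have nf: "norm (f z) = c / 86 * (h / norm (D z)) ^ 4" if "norm z < 1" for z
    using that c h by (simp add: f_def norm_mult norm_power norm_divide)
  have hol: "(\<lambda>z. of_real (c / 86) * (of_real h / D z) ^ 4) holomorphic_on ball 0 1"
    unfolding D_def using D0 by (intro holomorphic_intros) (auto simp: D_def)
  have f_hol: "f holomorphic_on ball 0 1"
    by (rule holomorphic_transform[OF hol]) (simp add: f_def)
  have fm: "f \<in> borel_measurable borel"
    unfolding f_def D_def mem_ball_0 by measurable
  \<comment> \<open>The zero of \<open>D\<close>, i.e. the pole of the test function; its distance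
    to the unit disc is the quantity \<open>h'\<close> below.\<close>
  define p where "p = xi / of_real (1 - h)"
  have Dp: "norm (D z) = (1 - h) * dist p z" for z
  proof -
    have "cnj xi * xi = 1" using xi complex_norm_square[of xi] by (simp add: mult.commute)
    then have "D z = of_real (1 - h) * cnj xi * (p - z)"
      using h by (simp add: D_def p_def algebra_simps del: of_real_diff)
    then show ?thesis using h by (simp add: norm_mult xi dist_norm del: of_real_diff)
  qed
  define h' where "h' = h / (1 - h)"
  have h': "0 < h'" "h' \<le> 2 * h" using h by (auto simp: h'_def field_simps)
  define F where "F z = (if norm z < 1 then (h / norm (D z)) ^ 4 else 0)" for z
  have F0: "0 \<le> F z" for z using h by (simp add: F_def)
  have Fm: "F \<in> borel_measurable borel" unfolding F_def D_def by measurable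
  have "(\<integral>\<^sup>+ z. ennreal (F z) \<partial>areaD) \<le> ennreal (64 / 3 * h'\<^sup>2)"
  proof (rule nn_integral_areaD_inverse_fourth_power[where p = p])
    fix z assume "F z \<noteq> 0"
    then have z: "norm z < 1" by (auto simp: F_def split: if_splits)
    have "h' \<le> dist p z" using D_ge_h[OF z] h by (simp add: Dp h'_def divide_le_eq mult.commute)
    moreover have "h / norm (D z) = h' / dist p z" by (simp add: Dp h'_def)
    ultimately show "h' \<le> dist p z \<and> F z \<le> (h' / dist p z) ^ 4" using z by (simp add: F_def)
  qed (rule h')
  also have "\<dots> \<le> ennreal (86 * h\<^sup>2)"
  \<comment> \<open>As \<open>h'\<close> is at most \<open>2 * h\<close>, the constant is
    \<open>4 * 64 / 3 = 256 / 3\<close>, just below 86.\<close>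
  proof (rule ennreal_leI)
    have "h'\<^sup>2 \<le> (2 * h)\<^sup>2" using h' by (intro power_mono) auto
    then have "h'\<^sup>2 \<le> 4 * h\<^sup>2" by (simp add: power_mult_distrib)
    then show "64 / 3 * h'\<^sup>2 \<le> 86 * h\<^sup>2" using zero_le_power2[of h] by linarith
  qed
  finally have F_int: "(\<integral>\<^sup>+ z. ennreal (F z) \<partial>areaD) \<le> ennreal (86 * h\<^sup>2)" .
  have "(\<integral>\<^sup>+ z. ennreal (P (norm (f z) / 1)) \<partial>areaD) \<le> (\<integral>\<^sup>+ z. ennreal (1 / (86 * h\<^sup>2)) * ennreal (F z) \<partial>areaD)"
  proof (rule nn_integral_mono)
    fix z
    show "ennreal (P (norm (f z) / 1)) \<le> ennreal (1 / (86 * h\<^sup>2)) * ennreal (F z)"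
    proof (cases "norm z < 1")
      case True
      have "h / norm (D z) \<le> 1" using D_ge_h[OF True] h by (simp add: divide_le_eq)
      then have F1: "F z \<le> 1" using True h by (simp add: F_def power_le_one)
      have "P (norm (f z)) = P (F z / 86 * c)" using True by (simp add: nf F_def mult.commute)
      also have "\<dots> \<le> F z / 86 * P c" using c F0[of z] F1 by (intro orlicz_scale[OF P]) auto
      also have "\<dots> = 1 / (86 * h\<^sup>2) * F z" by (simp add: c)
      finally have "ennreal (P (norm (f z))) \<le> ennreal (1 / (86 * h\<^sup>2) * F z)" by (rule ennreal_leI)
      also have "\<dots> = ennreal (1 / (86 * h\<^sup>2)) * ennreal (F z)"
        by (rule ennreal_mult) (auto simp: F0)
      finally show ?thesis by simp
    qed (simp add: f_def orlicz_zero[OF P])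
  qed
  also have "\<dots> = ennreal (1 / (86 * h\<^sup>2)) * (\<integral>\<^sup>+ z. ennreal (F z) \<partial>areaD)"
    using Fm by (intro nn_integral_cmult) (auto intro: measurable_compose[OF _ measurable_ennreal] simp: measurable_cong_sets[OF sets_areaD refl])
  also have "\<dots> \<le> ennreal (1 / (86 * h\<^sup>2)) * ennreal (86 * h\<^sup>2)"
    by (intro mult_left_mono F_int) auto
  also have "\<dots> = ennreal (1 / (86 * h\<^sup>2) * (86 * h\<^sup>2))" by (rule ennreal_mult[symmetric]) auto
  also have "\<dots> = 1" using h by simp
  finally have mod: "(\<integral>\<^sup>+ z. ennreal (P (norm (f z) / 1)) \<partial>areaD) \<le> 1" .
  show thesis
  proof (rule that[of f])
    show "f \<in> bergman_orlicz P"
      using f_hol fm mod unfolding bergman_orlicz_def in_orlicz_def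
      by (auto simp: f_def measurable_cong_sets[OF sets_areaD refl] intro!: exI[of _ 1])
    show "lux_norm areaD P f \<le> 1" using mod by (intro lux_norm_bounds) auto
  next
    fix z assume z: "z \<in> window xi h"
    then have z1: "norm z < 1" by (simp add: window_def)
    have "norm (D z) \<le> 6 * h" unfolding D_def using h by (intro norm_window_le[OF xi _ _ z]) auto
    then have "1 / 6 \<le> h / norm (D z)" using h D0[OF z1] by (simp add: field_simps)
    then have "(1 / 6) ^ 4 \<le> (h / norm (D z)) ^ 4" by (intro power_mono) auto
    then have "c / 86 * (1 / 6) ^ 4 \<le> norm (f z)" unfolding nf[OF z1] using c by (intro mult_left_mono) auto
    then show "orlicz_inv P (1 / h\<^sup>2) / (86 * 6 ^ 4) \<le> norm (f z)" by (simp add: c_def power_divide)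
  next
    fix z :: complex assume z: "norm z < 1"
    have "norm (f z) \<le> c * (h / norm (D z)) ^ 4"
      unfolding nf[OF z] using c h by (intro mult_right_mono) auto
    also have "\<dots> \<le> c * (h / (1 - norm z)) ^ 4"
      using D_ge_1[OF z] z h c by (intro mult_left_mono power_mono divide_left_mono) (auto simp: D0)
    finally show "norm (f z) \<le> orlicz_inv P (1 / h\<^sup>2) * (h / (1 - norm z)) ^ 4" by (simp add: c_def)
  qed
qed

text \<open>Beyond 1 convexity forces \<open>P\<close> to grow at least linearly, so its inverse
  grows at most linearly. Hence \<open>h^4\<close> times the inverse at \<open>1 / h^2\<close> tends
  to 0.\<close>

lemma orlicz_inv_le_affine:
  assumes P: "orlicz_fun P" and y: "0 \<le> y"
  shows "orlicz_inv P y \<le> 1 + y / P 1"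
proof (cases "orlicz_inv P y \<le> 1")
  case True
  then show ?thesis using y orlicz_nonneg[OF P, of 1] by (intro add_increasing2) auto
next
  case False
  define x where "x = orlicz_inv P y"
  have x: "1 < x" "P x = y" using False orlicz_inv[OF P y] by (auto simp: x_def)
  have "P (1 / x * x) \<le> 1 / x * P x" using x by (intro orlicz_scale[OF P]) auto
  then have "x * P 1 \<le> y" using x by (simp add: field_simps)
  then have "x \<le> y / P 1" using orlicz_pos[OF P, of 1] by (simp add: pos_le_divide_eq)
  then show ?thesis by (simp add: x_def)
qed

text \<open>Doubling a common constant makes the difference a midpoint, whose modular is finite by
  convexity.\<close>

lemma in_orlicz_diff:
  assumes P: "orlicz_fun P" and f: "in_orlicz M P f" and g: "in_orlicz M P g"
  shows "in_orlicz M P (\<lambda>z. f z - g z)"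
proof -
  obtain C1 C2 where C: "0 < C1" "(\<integral>\<^sup>+ z. ennreal (P (norm (f z) / C1)) \<partial>M) \<le> 1"
    "0 < C2" "(\<integral>\<^sup>+ z. ennreal (P (norm (g z) / C2)) \<partial>M) \<le> 1"
    using f g by (auto simp: in_orlicz_def)
  have fg: "f \<in> borel_measurable M" "g \<in> borel_measurable M" using f g by (auto simp: in_orlicz_def)
  define K where "K = max C1 C2"
  have K: "0 < K" "C1 \<le> K" "C2 \<le> K" using C by (auto simp: K_def)
  have m: "(\<lambda>z. ennreal (P (norm (f z) / K))) \<in> borel_measurable M"
    "(\<lambda>z. ennreal (P (norm (g z) / K))) \<in> borel_measurable M"
    using fg K by (auto intro!: measurable_compose[OF _ measurable_ennreal] orlicz_measurable[OF P])
  have "(\<integral>\<^sup>+ z. ennreal (P (norm (f z - g z) / (2 * K))) \<partial>M)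
    \<le> (\<integral>\<^sup>+ z. ennreal (P (norm (f z) / K)) + ennreal (P (norm (g z) / K)) \<partial>M)"
  proof (rule nn_integral_mono)
    fix z
    have "norm (f z - g z) / (2 * K) \<le> (norm (f z) + norm (g z)) / (2 * K)"
      using norm_triangle_ineq4[of "f z" "g z"] K by (intro divide_right_mono) auto
    also have "\<dots> = (1 - 1/2) * (norm (f z) / K) + 1/2 * (norm (g z) / K)"
      using K by (simp add: field_simps)
    finally have "P (norm (f z - g z) / (2 * K)) \<le> P \<dots>"
      using K by (intro orlicz_mono[OF P]) auto
    also have "\<dots> \<le> (1 - 1/2) * P (norm (f z) / K) + 1/2 * P (norm (g z) / K)"
      using K by (intro orlicz_convexD[OF P]) auto
    also have "\<dots> \<le> P (norm (f z) / K) + P (norm (g z) / K)"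
      using K orlicz_nonneg[OF P, of "norm (f z) / K"] orlicz_nonneg[OF P, of "norm (g z) / K"] by simp
    finally have "ennreal (P (norm (f z - g z) / (2 * K))) \<le> ennreal (P (norm (f z) / K) + P (norm (g z) / K))"
      by (rule ennreal_leI)
    also have "\<dots> = ennreal (P (norm (f z) / K)) + ennreal (P (norm (g z) / K))"
      using K by (intro ennreal_plus orlicz_nonneg[OF P]) auto
    finally show "ennreal (P (norm (f z - g z) / (2 * K)))
      \<le> ennreal (P (norm (f z) / K)) + ennreal (P (norm (g z) / K))" .
  qed
  also have "\<dots> = (\<integral>\<^sup>+ z. ennreal (P (norm (f z) / K)) \<partial>M) + (\<integral>\<^sup>+ z. ennreal (P (norm (g z) / K)) \<partial>M)"
    by (rule nn_integral_add[OF m])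
  also have "\<dots> \<le> 1 + 1"
    using C K modular_antimono[OF P, of C1 K M f] modular_antimono[OF P, of C2 K M g]
    by (intro add_mono) (auto intro: order_trans)
  also have "\<dots> < \<infinity>" by simp
  finally show ?thesis
    using fg K by (intro in_orlicz_if_finite[OF P, of _ _ "2 * K"]) auto
qed

section \<open>Necessity for the embedding\<close>

context disc_measure
begin

text \<open>Identifies the norm limit with the pointwise one. Fatou's lemma bounds the modular of
  \<open>g / d\<close> by 1 for every \<open>d > 0\<close>, so \<open>g\<close> has norm
  zero.\<close>

lemma limit_AE_zero:
  assumes P: "orlicz_fun P" and f: "\<And>n. in_orlicz mu P (f n)" and g: "in_orlicz mu P g"
    and ptw: "\<And>z. (\<lambda>n. f n z) \<longlonglongrightarrow> 0"
    and lux: "(\<lambda>n. lux_norm mu P (\<lambda>z. f n z - g z)) \<longlonglongrightarrow> 0"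
  shows "AE z in mu. g z = 0"
proof -
  have fm [measurable]: "f n \<in> borel_measurable mu" for n using f[of n] by (simp add: in_orlicz_def)
  have gm [measurable]: "g \<in> borel_measurable mu" using g by (simp add: in_orlicz_def)
  have [measurable]: "(\<lambda>z. P (norm (g z))) \<in> borel_measurable mu"
    by (rule orlicz_measurable[OF P]) auto
  have le1: "(\<integral>\<^sup>+ z. ennreal (P (norm (g z) / d)) \<partial>mu) \<le> 1" if d: "0 < d" for d
  proof -
    have "\<forall>\<^sub>F n in sequentially. lux_norm mu P (\<lambda>z. f n z - g z) < d"
      using lux d by (rule order_tendstoD)
    then have ev: "\<forall>\<^sub>F n in sequentially. (\<integral>\<^sup>+ z. ennreal (P (norm (f n z - g z) / d)) \<partial>mu) \<le> 1"
      by eventually_elim (rule lux_norm_lessD(2)[OF P in_orlicz_diff[OF P f g]])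
    have "(\<integral>\<^sup>+ z. ennreal (P (norm (g z) / d)) \<partial>mu)
      = (\<integral>\<^sup>+ z. liminf (\<lambda>n. ennreal (P (norm (f n z - g z) / d))) \<partial>mu)"
    proof (rule nn_integral_cong)
      fix z
      have "(\<lambda>n. norm (f n z - g z) / d) \<longlonglongrightarrow> norm (0 - g z) / d"
        by (intro tendsto_intros ptw) (use d in simp)
      then have "(\<lambda>n. P (norm (f n z - g z) / d)) \<longlonglongrightarrow> P (norm (g z) / d)"
        by (intro continuous_on_tendsto_compose[OF orlicz_continuous_on[OF P]]) (use d in auto)
      then have "(\<lambda>n. ennreal (P (norm (f n z - g z) / d))) \<longlonglongrightarrow> ennreal (P (norm (g z) / d))"
        by (rule tendsto_ennrealI)
      then show "ennreal (P (norm (g z) / d)) = liminf (\<lambda>n. ennreal (P (norm (f n z - g z) / d)))"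
        by (intro lim_imp_Liminf[symmetric]) auto
    qed
    also have "\<dots> \<le> liminf (\<lambda>n. \<integral>\<^sup>+ z. ennreal (P (norm (f n z - g z) / d)) \<partial>mu)"
    proof (rule nn_integral_liminf)
      fix n
      have "(\<lambda>z. norm (f n z - g z) / d) \<in> borel_measurable mu" by measurable
      then show "(\<lambda>z. ennreal (P (norm (f n z - g z) / d))) \<in> borel_measurable mu"
        using d by (intro measurable_compose[OF _ measurable_ennreal] orlicz_measurable[OF P]) auto
    qed
    also have "\<dots> \<le> limsup (\<lambda>n. \<integral>\<^sup>+ z. ennreal (P (norm (f n z - g z) / d)) \<partial>mu)"
      by (rule Liminf_le_Limsup) simp
    also have "\<dots> \<le> 1" by (rule Limsup_bounded[OF ev])
    finally show ?thesis .
  qed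
  have "(\<integral>\<^sup>+ z. ennreal (P (norm (g z))) \<partial>mu) \<le> 0"
  proof (rule ennreal_le_epsilon)
    fix e :: real assume e: "0 < e"
    \<comment> \<open>Scaling out the factor \<open>d\<close> needs \<open>d \<le> 1\<close>; the
      modular of \<open>g\<close> is then at most \<open>d\<close>, hence at most
      \<open>e\<close>.\<close>
    define d where "d = min e 1"
    have d: "0 < d" "d \<le> 1" "d \<le> e" using e by (auto simp: d_def)
    have m: "(\<lambda>z. ennreal (P (norm (g z) / d))) \<in> borel_measurable mu"
      using d by (intro measurable_compose[OF _ measurable_ennreal] orlicz_measurable[OF P]) auto
    have "(\<integral>\<^sup>+ z. ennreal (P (norm (g z))) \<partial>mu) \<le> (\<integral>\<^sup>+ z. ennreal d * ennreal (P (norm (g z) / d)) \<partial>mu)"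
    proof (rule nn_integral_mono)
      fix z
      have "P (d * (norm (g z) / d)) \<le> d * P (norm (g z) / d)"
        using d by (intro orlicz_scale[OF P]) auto
      then have "ennreal (P (norm (g z))) \<le> ennreal (d * P (norm (g z) / d))"
        using d by (intro ennreal_leI) simp
      also have "\<dots> = ennreal d * ennreal (P (norm (g z) / d))"
        using d by (intro ennreal_mult orlicz_nonneg[OF P]) auto
      finally show "ennreal (P (norm (g z))) \<le> ennreal d * ennreal (P (norm (g z) / d))" .
    qed
    also have "\<dots> = ennreal d * (\<integral>\<^sup>+ z. ennreal (P (norm (g z) / d)) \<partial>mu)"
      by (rule nn_integral_cmult[OF m])
    also have "\<dots> \<le> ennreal d * 1" using d by (intro mult_left_mono le1) auto
    also have "\<dots> \<le> 0 + ennreal e" using d by (simp add: ennreal_leI)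
    finally show "(\<integral>\<^sup>+ z. ennreal (P (norm (g z))) \<partial>mu) \<le> 0 + ennreal e" .
  qed
  then have "(\<integral>\<^sup>+ z. ennreal (P (norm (g z))) \<partial>mu) = 0" by simp
  then have "AE z in mu. ennreal (P (norm (g z))) = 0"
    by (subst (asm) nn_integral_0_iff_AE) measurable
  then show ?thesis
  proof eventually_elim
    case (elim z)
    then show ?case using orlicz_pos[OF P, of "norm (g z)"] by (fastforce simp: ennreal_eq_0_iff)
  qed
qed

text \<open>If the bound failed along scales tending to 0, the test functions at nearly optimal
  windows would have a norm-convergent subsequence with limit 0, while their size on the windows
  keeps the modulars large.\<close>

lemma compact_embedding_necessary:
  assumes P1: "orlicz_fun P1" and P2: "orlicz_fun P2"
    and compact: "compact_embedding mu P1 P2" and e: "0 < e"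
  shows "\<exists>h0>0. \<forall>h\<in>{0<..<h0}. rho mu h * P2 (orlicz_inv P1 (1 / h\<^sup>2) / e) \<le> 1"
proof (rule ccontr)
  assume "\<not> ?thesis"
  then have neg: "\<exists>h\<in>{0<..<h0}. 1 < rho mu h * P2 (orlicz_inv P1 (1 / h\<^sup>2) / e)" if "0 < h0" for h0
    using that by (auto simp: not_le)
  \<comment> \<open>The shift by 2 keeps every scale below 1/2, as the test functions require, while
    the scales still tend to 0.\<close>
  have "\<forall>n::nat. \<exists>h. 0 < h \<and> h < 1 / real (n + 2) \<and> 1 < rho mu h * P2 (orlicz_inv P1 (1 / h\<^sup>2) / e)"
  proof
    fix n :: nat
    show "\<exists>h. 0 < h \<and> h < 1 / real (n + 2) \<and> 1 < rho mu h * P2 (orlicz_inv P1 (1 / h\<^sup>2) / e)"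
      using neg[of "1 / real (n + 2)"] by auto
  qed
  then obtain h where h: "\<And>n. 0 < h n" "\<And>n::nat. h n < 1 / real (n + 2)"
    and big: "\<And>n. 1 < rho mu (h n) * P2 (orlicz_inv P1 (1 / (h n)\<^sup>2) / e)" by metis
  define c where "c n = orlicz_inv P1 (1 / (h n)\<^sup>2)" for n
  have c0: "0 \<le> c n" for n unfolding c_def by (intro orlicz_inv_nonneg[OF P1]) auto
  have h_half: "h n \<le> 1/2" for n
  proof -
    have "1 / real (n + 2) \<le> 1 / 2" by (intro frac_le) auto
    then show ?thesis using h(2)[of n] by linarith
  qed
  have "\<exists>xi. norm xi = 1 \<and> rho mu (h n) / 2 < measure mu (window xi (h n))" for n
  proof -
    have "rho mu (h n) \<noteq> 0" using big[of n] by auto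
    then have "0 < rho mu (h n)" using rho_nonneg[of "h n"] by simp
    then show ?thesis by (rule rho_attained) auto
  qed
  then obtain xi where xi: "\<And>n. norm (xi n) = 1" "\<And>n. rho mu (h n) / 2 < measure mu (window (xi n) (h n))"
    by metis
  have "\<exists>f. f \<in> bergman_orlicz P1 \<and> lux_norm areaD P1 f \<le> 1 \<and>
      (\<forall>z\<in>window (xi n) (h n). c n / (86 * 6 ^ 4) \<le> norm (f z)) \<and>
      (\<forall>z. norm z < 1 \<longrightarrow> norm (f z) \<le> c n * (h n / (1 - norm z)) ^ 4)" for n
    unfolding c_def by (rule test_function[OF P1 xi(1) h(1) h_half]) blast
  then obtain f where f: "\<And>n. f n \<in> bergman_orlicz P1" "\<And>n. lux_norm areaD P1 (f n) \<le> 1"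
    and f_low: "\<And>n z. z \<in> window (xi n) (h n) \<Longrightarrow> c n / (86 * 6 ^ 4) \<le> norm (f n z)"
    and f_up: "\<And>n z. norm z < 1 \<Longrightarrow> norm (f n z) \<le> c n * (h n / (1 - norm z)) ^ 4"
    by metis
  obtain s g where s: "strict_mono (s :: nat \<Rightarrow> nat)" and g: "in_orlicz mu P2 g"
    and lux: "(\<lambda>n. lux_norm mu P2 (\<lambda>z. f (s n) z - g z)) \<longlonglongrightarrow> 0"
    using compact f unfolding compact_embedding_def by blast
  have f_orl: "in_orlicz mu P2 (f n)" for n
    using compact f(1) unfolding compact_embedding_def by blast
  have h_lim: "h \<longlonglongrightarrow> 0"
  proof (rule tendsto_sandwich[of "\<lambda>_. 0" h sequentially "\<lambda>n. 1 / real (n + 2)"])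
    show "(\<lambda>n. 1 / real (n + 2)) \<longlonglongrightarrow> 0"
      by (rule LIMSEQ_ignore_initial_segment[OF lim_1_over_n])
  qed (use h in \<open>auto intro!: always_eventually less_imp_le\<close>)
  have f_lim: "(\<lambda>n. f n z) \<longlonglongrightarrow> 0" for z
  proof (cases "norm z < 1")
    case True
    \<comment> \<open>The affine bound on the inverse turns the amplitude times \<open>h^4\<close>
      into this expression, which vanishes in the limit.\<close>
    have "(\<lambda>n. ((h n) ^ 4 + (h n)\<^sup>2 / P1 1) / (1 - norm z) ^ 4) \<longlonglongrightarrow> (0 ^ 4 + 0\<^sup>2 / P1 1) / (1 - norm z) ^ 4"
      by (intro tendsto_intros h_lim) (use True orlicz_pos[OF P1, of 1] in auto)
    then have lim: "(\<lambda>n. ((h n) ^ 4 + (h n)\<^sup>2 / P1 1) / (1 - norm z) ^ 4) \<longlonglongrightarrow> 0" by simp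
    show ?thesis
    proof (rule Lim_null_comparison[OF always_eventually lim], rule allI)
      fix n
      have "norm (f n z) \<le> c n * (h n / (1 - norm z)) ^ 4" by (rule f_up[OF True])
      also have "\<dots> \<le> (1 + 1 / (h n)\<^sup>2 / P1 1) * (h n / (1 - norm z)) ^ 4"
        unfolding c_def using True h(1)[of n]
        by (intro mult_right_mono orlicz_inv_le_affine[OF P1]) auto
      also have "\<dots> = ((h n) ^ 4 + (h n)\<^sup>2 / P1 1) / (1 - norm z) ^ 4"
        using h(1)[of n] by (simp add: power_divide field_simps power4_eq_xxxx power2_eq_square)
      finally show "norm (f n z) \<le> ((h n) ^ 4 + (h n)\<^sup>2 / P1 1) / (1 - norm z) ^ 4" .
    qed
  next
    case False
    then have "f n z = 0" for n using f(1)[of n] by (simp add: bergman_orlicz_def)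
    then show ?thesis by simp
  qed
  have "(\<lambda>n. f (s n) z) \<longlonglongrightarrow> 0" for z
    using LIMSEQ_subseq_LIMSEQ[OF f_lim s] by (simp add: o_def)
  then have g0: "AE z in mu. g z = 0"
    by (intro limit_AE_zero[OF P2 f_orl g _ lux])
  \<comment> \<open>The constant in the lower bound of the test functions on their windows. The
    threshold \<open>k * e / 2\<close> gains a factor 2, compensating for windows that carry only
    half of \<open>rho\<close>.\<close>
  define k :: real where "k = 1 / (86 * 6 ^ 4)"
  have k: "0 < k" by (simp add: k_def)
  have "\<forall>\<^sub>F n in sequentially. lux_norm mu P2 (\<lambda>z. f (s n) z - g z) < k * e / 2"
    using lux by (rule order_tendstoD) (use k e in simp)
  then obtain n where n: "lux_norm mu P2 (\<lambda>z. f (s n) z - g z) < k * e / 2"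
    using eventually_happens'[OF sequentially_bot] by blast
  \<comment> \<open>One index suffices: the failure of the bound was arranged at every scale
    \<open>h m\<close>.\<close>
  define m where "m = s n"
  have "(\<integral>\<^sup>+ z. ennreal (P2 (norm (f m z - g z) / (k * e / 2))) \<partial>mu) \<le> 1"
    unfolding m_def by (rule lux_norm_lessD(2)[OF P2 in_orlicz_diff[OF P2 f_orl g] n])
  moreover have "(\<integral>\<^sup>+ z. ennreal (P2 (norm (f m z - g z) / (k * e / 2))) \<partial>mu)
      = (\<integral>\<^sup>+ z. ennreal (P2 (norm (f m z) / (k * e / 2))) \<partial>mu)"
    by (rule nn_integral_cong_AE) (use g0 in eventually_elim, simp)
  ultimately have int1: "(\<integral>\<^sup>+ z. ennreal (P2 (norm (f m z) / (k * e / 2))) \<partial>mu) \<le> 1" by simp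
  define W where "W = window (xi m) (h m)"
  have W: "W \<in> sets mu"
    unfolding W_def sets_mu using h(1)[of m] h_half[of m] by (intro window_measurable xi) auto
  have "ennreal (P2 (2 * (c m / e)) * measure mu W) = ennreal (P2 (2 * (c m / e))) * emeasure mu W"
    using c0[of m] e by (simp add: emeasure_eq_measure ennreal_mult orlicz_nonneg[OF P2])
  also have "\<dots> = (\<integral>\<^sup>+ z. ennreal (P2 (2 * (c m / e))) * indicator W z \<partial>mu)"
    by (rule nn_integral_cmult_indicator[OF W, symmetric])
  also have "\<dots> \<le> (\<integral>\<^sup>+ z. ennreal (P2 (norm (f m z) / (k * e / 2))) \<partial>mu)"
  proof (rule nn_integral_mono)
    fix z
    show "ennreal (P2 (2 * (c m / e))) * indicator W z \<le> ennreal (P2 (norm (f m z) / (k * e / 2)))"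
    proof (cases "z \<in> W")
      case True
      then have "c m * k \<le> norm (f m z)" using f_low[of z m] by (simp add: W_def k_def)
      then have "2 * (c m / e) \<le> norm (f m z) / (k * e / 2)"
        using k e by (simp add: field_simps)
      then have "P2 (2 * (c m / e)) \<le> P2 (norm (f m z) / (k * e / 2))"
        using c0[of m] e by (intro orlicz_mono[OF P2]) auto
      then show ?thesis using True by (simp add: ennreal_leI)
    qed simp
  qed
  also note int1
  finally have W1: "P2 (2 * (c m / e)) * measure mu W \<le> 1" by (simp add: ennreal_le_1)
  have "P2 (1/2 * (2 * (c m / e))) \<le> 1/2 * P2 (2 * (c m / e))"
    using c0[of m] e by (intro orlicz_scale[OF P2]) auto
  then have half: "2 * P2 (c m / e) \<le> P2 (2 * (c m / e))" by simp
  have Pm: "0 \<le> P2 (c m / e)" using c0[of m] e by (intro orlicz_nonneg[OF P2]) auto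
  have "rho mu (h m) * P2 (c m / e) = 2 * P2 (c m / e) * (rho mu (h m) / 2)" by simp
  also have "\<dots> \<le> P2 (2 * (c m / e)) * measure mu W"
    using xi(2)[of m] half Pm rho_nonneg[of "h m"] by (intro mult_mono) (auto simp: W_def)
  also note W1
  finally show False using big[of m] by (simp add: c_def)
qed

section \<open>Translation between extended-real ratios and elementary inequalities\<close>

lemma ratio_tendsto_0I:
  assumes P1: "orlicz_fun P1" and P2: "orlicz_fun P2"
    and bound: "\<And>e. 0 < e \<Longrightarrow> \<exists>h0>0. \<forall>h\<in>{0<..<h0}. rho mu h * P2 (orlicz_inv P1 (1 / h\<^sup>2) / e) \<le> 1"
  shows "((\<lambda>h. orlicz_inv_e P1 (ereal (1 / h ^ 2)) / orlicz_inv_e P2 (1 / ereal (rho mu h))) \<longlongrightarrow> 0) (at_right 0)"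
proof -
  \<comment> \<open>If \<open>rho\<close> vanishes, the extended inverse is infinite and the
    quotient is 0, so the ratio is real-valued at every \<open>h\<close>.\<close>
  define q where "q h = (if rho mu h = 0 then 0 else orlicz_inv P1 (1 / h\<^sup>2) / orlicz_inv P2 (1 / rho mu h))" for h
  have eq: "orlicz_inv_e P1 (ereal (1 / h ^ 2)) / orlicz_inv_e P2 (1 / ereal (rho mu h)) = ereal (q h)" for h
  proof (cases "rho mu h = 0")
    case True
    then show ?thesis by (simp add: q_def orlicz_inv_e_def)
  next
    case False
    then have r: "0 < rho mu h" using rho_nonneg[of h] by simp
    have "orlicz_inv P2 (1 / rho mu h) \<noteq> 0"
    proof
      assume "orlicz_inv P2 (1 / rho mu h) = 0"
      then have "1 / rho mu h = 0"
        using orlicz_orlicz_inv[OF P2, of "1 / rho mu h"] r orlicz_zero[OF P2] by simp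
      then show False using r by simp
    qed
    then show ?thesis using False by (simp add: q_def orlicz_inv_e_def one_ereal_def)
  qed
  have "(q \<longlongrightarrow> 0) (at_right 0)"
  proof (rule tendstoI)
    fix e :: real assume e: "0 < e"
    obtain h0 where h0: "0 < h0" "\<And>h. 0 < h \<Longrightarrow> h < h0 \<Longrightarrow> rho mu h * P2 (orlicz_inv P1 (1 / h\<^sup>2) / (e / 2)) \<le> 1"
      using bound[of "e / 2"] e by auto
    have "dist (q h) 0 < e" if h: "0 < h" "h < h0" for h
    proof (cases "rho mu h = 0")
      case False
      then have r: "0 < rho mu h" using rho_nonneg[of h] by simp
      define x y where "x = orlicz_inv P1 (1 / h\<^sup>2)" and "y = orlicz_inv P2 (1 / rho mu h)"
      have x: "0 \<le> x" unfolding x_def by (intro orlicz_inv_nonneg[OF P1]) auto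
      have y: "0 \<le> y" unfolding y_def using r by (intro orlicz_inv_nonneg[OF P2]) auto
      have "P2 (x / (e / 2)) \<le> 1 / rho mu h"
        using h0(2)[OF h] r by (simp add: x_def pos_le_divide_eq mult.commute)
      then have "x / (e / 2) \<le> y"
        unfolding y_def using x e r by (subst le_orlicz_inv_iff[OF P2]) auto
      then have "x \<le> y * (e / 2)" using e by (simp add: pos_divide_le_eq)
      then have "x / y \<le> e / 2" using y e by (cases "y = 0") (auto simp: pos_divide_le_eq mult.commute)
      moreover have "0 \<le> x / y" using x y by simp
      moreover have "q h = x / y" using False by (simp add: q_def x_def y_def)
      ultimately have "0 \<le> q h" "q h \<le> e / 2" by simp_all
      then show ?thesis using e unfolding dist_real_def by linarith
    qed (simp add: q_def e)
    then show "\<forall>\<^sub>F h in at_right 0. dist (q h) 0 < e"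
      using h0(1) unfolding eventually_at_right_field by blast
  qed
  then show ?thesis unfolding eq zero_ereal_def by (rule tendsto_ereal)
qed

text \<open>The required \<open>k\<close> is the real value of \<open>K2 mu h\<close>. A ratio below
  \<open>1 / A\<close> forces \<open>A\<close> times the numerator below the denominator, and
  applying \<open>P2\<close> gives the product bound.\<close>

lemma ratio_tendsto_0D:
  assumes P1: "orlicz_fun P1" and P2: "orlicz_fun P2"
    and lim: "((\<lambda>h. orlicz_inv_e P1 (ereal (1 / h ^ 2)) /
                  orlicz_inv_e P2 (1 / (ereal (h ^ 2) * K2 mu h))) \<longlongrightarrow> 0) (at_right 0)"
    and A: "0 < A"
  shows "\<exists>h0>0. \<forall>h\<in>{0<..<h0}. \<exists>k. (\<forall>t\<in>{0<..<h}. rho mu t \<le> k * t\<^sup>2)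
        \<and> k * h\<^sup>2 * P2 (A * orlicz_inv P1 (1 / h\<^sup>2)) \<le> 1"
proof -
  have "\<forall>\<^sub>F h in at_right 0. orlicz_inv_e P1 (ereal (1 / h ^ 2)) /
                  orlicz_inv_e P2 (1 / (ereal (h ^ 2) * K2 mu h)) < ereal (1 / A)"
    using lim by (rule order_tendstoD) (use A in simp)
  then obtain h0 where h0: "0 < h0" and less: "\<And>h. 0 < h \<Longrightarrow> h < h0 \<Longrightarrow>
      orlicz_inv_e P1 (ereal (1 / h ^ 2)) / orlicz_inv_e P2 (1 / (ereal (h ^ 2) * K2 mu h)) < ereal (1 / A)"
    unfolding eventually_at_right_field by blast
  have "\<exists>k. (\<forall>t\<in>{0<..<h}. rho mu t \<le> k * t\<^sup>2) \<and> k * h\<^sup>2 * P2 (A * orlicz_inv P1 (1 / h\<^sup>2)) \<le> 1"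
    if h: "0 < h" "h < h0" for h
  proof -
    define x where "x = orlicz_inv P1 (1 / h\<^sup>2)"
    have Px: "P1 x = 1 / h\<^sup>2" and x0: "0 \<le> x" unfolding x_def by (auto simp: orlicz_inv[OF P1])
    have "x \<noteq> 0" using Px h orlicz_zero[OF P1] by auto
    then have x: "0 < x" using x0 by simp
    have less': "ereal x / orlicz_inv_e P2 (1 / (ereal (h ^ 2) * K2 mu h)) < ereal (1 / A)"
      using less[OF h] by (simp add: orlicz_inv_e_def x_def)
    have inv0: "orlicz_inv P2 0 = 0"
      using orlicz_inv_eq[OF P2, of 0] orlicz_zero[OF P2] by simp
    show ?thesis
    proof (cases "K2 mu h")
      \<comment> \<open>An infinite \<open>K2\<close> would make the denominator 0 and the ratio
        infinite, contradicting the bound \<open>1 / A\<close>.\<close>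
      case PInf
      then have "orlicz_inv_e P2 (1 / (ereal (h ^ 2) * K2 mu h)) = 0"
        using h by (simp add: orlicz_inv_e_def inv0)
      then show ?thesis using less' x by (simp add: divide_ereal_def)
    next
      case MInf
      then show ?thesis using K2_nonneg[OF h(1)] by simp
    next
      case (real k)
      have k0: "0 \<le> k" using K2_nonneg[OF h(1)] real by simp
      have "rho mu t \<le> k * t\<^sup>2" if t: "0 < t" "t < h" for t
      proof -
        have "ereal (rho mu t / t\<^sup>2) \<le> K2 mu h" unfolding K2_def using t by (intro SUP_upper) auto
        then show ?thesis using t by (simp add: real pos_divide_le_eq)
      qed
      moreover have "k * h\<^sup>2 * P2 (A * x) \<le> 1"
      proof (cases "k = 0")
        case False
        then have k: "0 < k" using k0 by simp
        define y where "y = orlicz_inv P2 (1 / (h\<^sup>2 * k))"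
        have Py: "P2 y = 1 / (h\<^sup>2 * k)" and y0: "0 \<le> y"
          unfolding y_def using k by (auto simp: orlicz_inv[OF P2])
        have "y \<noteq> 0" using Py h k orlicz_zero[OF P2] by auto
        then have y: "0 < y" using y0 by simp
        have "orlicz_inv_e P2 (1 / (ereal (h ^ 2) * K2 mu h)) = ereal y"
          using h k by (simp add: real orlicz_inv_e_def y_def one_ereal_def)
        then have "x / y < 1 / A" using less' y by simp
        then have "A * x \<le> y" using y A by (simp add: field_simps)
        then have "P2 (A * x) \<le> 1 / (h\<^sup>2 * k)" unfolding Py[symmetric] using A x0 by (intro orlicz_mono[OF P2]) auto
        then show ?thesis using h k by (simp add: pos_le_divide_eq mult_ac)
      qed simp
      ultimately show ?thesis unfolding x_def by (intro exI[of _ k]) auto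
    qed
  qed
  then show ?thesis using h0 by auto
qed

end

theorem theorem2p5:
  fixes mu :: "complex measure" and Psi1 Psi2 :: "real \<Rightarrow> real"
  assumes "sets mu = sets borel" and "finite_measure mu"
    and "emeasure mu (- ball 0 1) = 0"
    and "orlicz_fun Psi1" and "orlicz_fun Psi2"
  shows "(compact_embedding mu Psi1 Psi2 \<longrightarrow>
            ((\<lambda>h. orlicz_inv_e Psi1 (ereal (1 / h ^ 2)) /
                  orlicz_inv_e Psi2 (1 / ereal (rho mu h))) \<longlongrightarrow> 0) (at_right 0))
       \<and> (((\<lambda>h. orlicz_inv_e Psi1 (ereal (1 / h ^ 2)) /
                  orlicz_inv_e Psi2 (1 / (ereal (h ^ 2) * K2 mu h))) \<longlongrightarrow> 0) (at_right 0)
            \<longrightarrow> compact_embedding mu Psi1 Psi2)"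
proof (intro conjI impI)
  interpret disc_measure mu
    using assms by (intro disc_measure.intro disc_measure_axioms.intro)
  {
    assume "compact_embedding mu Psi1 Psi2"
    then show "((\<lambda>h. orlicz_inv_e Psi1 (ereal (1 / h ^ 2)) /
        orlicz_inv_e Psi2 (1 / ereal (rho mu h))) \<longlongrightarrow> 0) (at_right 0)"
      by (intro ratio_tendsto_0I compact_embedding_necessary assms)
  next
    assume "((\<lambda>h. orlicz_inv_e Psi1 (ereal (1 / h ^ 2)) /
        orlicz_inv_e Psi2 (1 / (ereal (h ^ 2) * K2 mu h))) \<longlongrightarrow> 0) (at_right 0)"
    then show "compact_embedding mu Psi1 Psi2"
      by (intro compact_embedding_sufficient ratio_tendsto_0D assms)
  }
qed

end
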